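(* Let $V(r)=+\infty$ for $r\in[0,1)$, $V(r)=-1$ for $r\in[1,\sqrt2]$, $V(r)=0$ for $r>\sqrt2$. (i) It holds $$-4N\le\mathcal E[V](N)\le-4N+O(N^{1/2}),$$ where $$-4=\lim_{N\to\infty}\frac{\mathcal E^{\mathbb{Z}^2}[V](N)}{N}=\lim_{R\to\infty}\frac{\mathcal E[V](\mathbb{Z}^2\cap B_R)}{\sharp(\mathbb{Z}^2\cap B_R)}.$$ (ii) If $X\in\mathcal C$ and if a point $x\in X$ has $8$ nearest neighbors in $\mathcal G_0(X)$, each of which in turn has $8$ nearest neighbors in $\mathcal G_0(X)$, then $\overline B(x,\sqrt2)\cap X$ equals, up to rotation and translation, $\overline B(0,\sqrt2)\cap\mathbb{Z}^2=\{-1,0,1\}^2$.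
   Context: For a finite set $X_N=\{x_1,\dots,x_N\}\subset\mathbb{R}^2$ of $N$ distinct points, $\mathcal E[V](X_N):=\frac12\sum_{i\ne j}V(|x_i-x_j|)$, and $\mathcal E[V](N):=\min\{\mathcal E[V](X_N):X_N\subset\mathbb{R}^2,\ \sharp X_N=N\}$. Also $\mathcal E^{\mathbb{Z}^2}[V](N):=\min\{\mathcal E[V](X_N): X_N\subset\mathbb{Z}^2,\ \sharp X_N=N\}$. $\mathcal C:=\{X\subset\mathbb{R}^2:\ |x-x'|\ge1\text{ for all }x\ne x'\in X\}$. For $X\in\mathcal C$, $\mathcal G_0(X)$ is the graph with vertex set $X$ and edge set $\mathcal S_0(X):=\{\{x,y\}: x,y\in X,\ |x-y|\in[1,\sqrt2]\}$; two points are nearest neighbors if they are joined by an edge. $B_R$ is the open ball of radius $R$ centered at $0$; $\overline B(x,\rho)$ is the closed ball with center $x$ and radius $\rho$. $O(N^{1/2})$ denotes a quantity bounded in absolute value by a constant times $N^{1/2}$ for large $N$. *)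

theory Defs
  imports "HOL-Analysis.Analysis" "HOL-Library.Landau_Symbols"
begin

text \<open>The value for negative arguments is irrelevant, since the potential is only ever
  evaluated at distances.\<close>

definition sticky_potential :: "real \<Rightarrow> ereal" where
  "sticky_potential r = (if r < 1 then \<infinity> else if r \<le> sqrt 2 then -1 else 0)"

definition square_lattice :: "(real ^ 2) set" where
  "square_lattice = {x. \<forall>i. x $ i \<in> \<int>}"

text \<open>The sum over ordered pairs of distinct indices becomes a sum over ordered pairs of
  distinct points; meaningful for finite \<open>X\<close>.\<close>

definition energy :: "(real \<Rightarrow> ereal) \<Rightarrow> (real ^ 2) set \<Rightarrow> ereal" where
  "energy V X = ereal (1/2) * (\<Sum>x\<in>X. \<Sum>y\<in>X - {x}. V (dist x y))"

text \<open>The minimum is rendered by \<open>LEAST\<close>, not by an infimum: statements about it carry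
  information only if the minimum is attained. The set \<open>A\<close> is the region
  to which the points are confined.\<close>

definition min_energy_in :: "(real ^ 2) set \<Rightarrow> (real \<Rightarrow> ereal) \<Rightarrow> nat \<Rightarrow> ereal" where
  "min_energy_in A V N = (LEAST e. \<exists>X\<subseteq>A. finite X \<and> card X = N \<and> e = energy V X)"

abbreviation min_energy :: "(real \<Rightarrow> ereal) \<Rightarrow> nat \<Rightarrow> ereal" where
  "min_energy \<equiv> min_energy_in UNIV"

abbreviation lattice_min_energy :: "(real \<Rightarrow> ereal) \<Rightarrow> nat \<Rightarrow> ereal" where
  "lattice_min_energy \<equiv> min_energy_in square_lattice"

definition hard_core_configs :: "(real ^ 2) set set" where
  "hard_core_configs = {X. \<forall>x\<in>X. \<forall>x'\<in>X. x \<noteq> x' \<longrightarrow> dist x x' \<ge> 1}"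

text \<open>The graph on the vertex set \<open>X\<close> is represented by its set of undirected edges.\<close>

definition edges0 :: "(real ^ 2) set \<Rightarrow> (real ^ 2) set set" where
  "edges0 X = {{x, y} | x y. x \<in> X \<and> y \<in> X \<and> dist x y \<in> {1..sqrt 2}}"

definition nearest_neighbors :: "(real ^ 2) set \<Rightarrow> real ^ 2 \<Rightarrow> (real ^ 2) set" where
  "nearest_neighbors X x = {y \<in> X. {x, y} \<in> edges0 X}"

end

theory Submission
  imports Defs "HOL-Real_Asymp.Real_Asymp"
begin

text \<open>
  \<^bold>\<open>Energy.\<close> For a configuration with pairwise distances at least 1 the energy is minus half the sum
  of the degrees in the neighbor graph. Two neighbors of the same point \<open>p\<close> have distances
  \<open>a, b \<in> [1, sqrt 2]\<close> from \<open>p\<close> and mutual distance at least 1, so by the law of cosines the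
  cosine of the angle between them is at most \<open>(a\<^sup>2 + b\<^sup>2 - 1) / (2 a b) \<le> 3/4\<close>. This angle therefore exceeds
  \<open>11 \<pi> / 48\<close> (41.25 degrees), nine neighbors do not fit around a point
  (\<open>nbrs_finite_card_le_8\<close>), and the energy is at least \<open>-4 N\<close>. Conversely, let \<open>K\<close> be convex.
  On each lattice line in a given direction at most one lattice point in \<open>K\<close> is the last one in
  \<open>K\<close>; so up to a multiple of the diameter of \<open>K\<close> all lattice points in \<open>K\<close> have all 8 lattice neighbors in
  \<open>K\<close> (\<open>energy_lattice_convex\<close>). Balls, and boxes filled row by row, are of this kind;
  the latter realise every cardinality.

  \<^bold>\<open>Rigidity.\<close> Let \<open>x\<close> and its 8 neighbors all have degree 8. The 8 sectors between
  consecutive neighbors \<open>p, q\<close> of \<open>x\<close> have angles with sum \<open>2 \<pi>\<close>, so \<open>\<pi>/4\<close> on average. The two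
  other angles of the triangle \<open>x p q\<close> are then large on average, namely \<open>3 \<pi> / 8\<close>.
  The point is that they are also lower bounds for angles between neighbors of \<open>p\<close>, and of \<open>q\<close>:
  a neighbor of \<open>p\<close> seen between the directions of \<open>x\<close> and \<open>q\<close> would lie behind the segment
  \<open>x q\<close>, so that two edges cross; but crossing edges are the diagonals of a unit square
  (\<open>crossing_edges_unit_square\<close>). In that exceptional case, which is the one of the square lattice, all three angles are replaced
  by \<open>\<pi>/4\<close> (\<open>sector_angles\<close>).
  On the other hand \<open>p\<close> has degree 8, and since six further angles at \<open>p\<close> exceed \<open>11 \<pi> / 48\<close> each, the two
  angles at \<open>p\<close> adjacent to the edge \<open>p x\<close> have a sum less than \<open>2 \<pi> - 6 \<cdot> 11 \<pi> / 48 = 5 \<pi> / 8\<close>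
  (\<open>angles_at_full_vertex\<close>). Compared with the sum \<open>\<pi>/2\<close> for two square sectors, this is an excess
  of less than \<open>\<pi>/8\<close> at each vertex \<open>p\<close> that belongs to a sector which is not square, whereas
  each such sector needs an excess of \<open>\<pi>/4\<close> and has only two such
  vertices. Hence every sector is part of a unit square (\<open>all_sectors_square\<close>), and going
  around \<open>x\<close> yields the lattice (\<open>full_neighborhood_king_moves\<close>).
\<close>

section \<open>The angle between two neighbors\<close>

text \<open>Angles are most convenient in the complex plane, so the geometry takes place there, and the
  results are transferred to Cartesian coordinates at the end.\<close>

definition hard_core :: "complex set \<Rightarrow> bool" where
  "hard_core X \<longleftrightarrow> (\<forall>x\<in>X. \<forall>y\<in>X. x \<noteq> y \<longrightarrow> 1 \<le> dist x y)"

definition nbrs :: "complex set \<Rightarrow> complex \<Rightarrow> complex set" where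
  "nbrs X x = {y \<in> X. y \<noteq> x \<and> dist x y \<le> sqrt 2}"

lemma nbrsD:
  assumes "hard_core X" "x \<in> X" "y \<in> nbrs X x"
  shows "y \<in> X" "y \<noteq> x" "1 \<le> cmod (y - x)" "cmod (y - x) \<le> sqrt 2"
  using assms by (auto simp: nbrs_def hard_core_def dist_norm norm_minus_commute)

lemma nbrs_sym: "x \<in> X \<Longrightarrow> y \<in> nbrs X x \<Longrightarrow> x \<in> nbrs X y"
  by (auto simp: nbrs_def dist_commute)

text \<open>A lower bound for \<open>arccos (3/4)\<close>, which is about 41.41 degrees. If neighbors could
  be separated by exactly \<open>11 \<pi> / 48\<close>, the angle balance of the rigidity argument would just be possible; the
  contradiction comes from the strict inequality.\<close>

definition sep_angle :: real where "sep_angle = 11 * pi / 48"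

lemma sep_angle_pos: "sep_angle > 0"
  by (simp add: sep_angle_def)

text \<open>Doubling the angle twice reduces the claim to \<open>cos (\<pi>/12) < 31/32\<close>, which concerns
  square roots only: if \<open>cos t = 3/4\<close> then \<open>cos (2 t) = 1/8\<close> and \<open>cos (4 t) = - 31/32\<close>.\<close>

lemma cos_sep_angle: "cos sep_angle > 3 / 4"
proof -
  have pos: "cos sep_angle > 0" "cos (2 * sep_angle) > 0"
    using pi_gt_zero by (auto intro!: cos_gt_zero_pi simp: sep_angle_def)
  have "cos (pi/6) = 2 * (cos (pi/12))\<^sup>2 - 1"
    using cos_double_cos[of "pi/12"] by simp
  then have "(cos (pi/12))\<^sup>2 = (2 + sqrt 3) / 4"
    by (simp add: cos_30 field_simps)
  moreover have "sqrt 3 < 1.75" by (rule real_less_lsqrt) (auto simp: power2_eq_square)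
  ultimately have "(cos (pi/12))\<^sup>2 < (31/32)\<^sup>2" by (simp add: power2_eq_square)
  then have "cos (pi/12) < 31/32" by (rule power2_less_imp_less) simp
  moreover have "cos (4 * sep_angle) = - cos (pi/12)"
  proof -
    have "4 * sep_angle = pi - pi/12" by (simp add: sep_angle_def)
    then show ?thesis by (metis cos_pi_minus)
  qed
  ultimately have "cos (4 * sep_angle) > - (31/32)" by simp
  moreover have "cos (4 * sep_angle) = 2 * (cos (2 * sep_angle))\<^sup>2 - 1"
    using cos_double_cos[of "2 * sep_angle"] by simp
  ultimately have "(1/8)\<^sup>2 < (cos (2 * sep_angle))\<^sup>2" by (simp add: power2_eq_square)
  then have "1/8 < cos (2 * sep_angle)" using pos by (intro power2_less_imp_less[of "1/8"]) auto
  moreover have "cos (2 * sep_angle) = 2 * (cos sep_angle)\<^sup>2 - 1"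
    using cos_double_cos[of "sep_angle"] by simp
  ultimately have "(3/4)\<^sup>2 < (cos sep_angle)\<^sup>2" by (simp add: power2_eq_square)
  then show ?thesis using pos by (intro power2_less_imp_less[of "3/4"]) auto
qed

text \<open>For fixed \<open>t\<close> the difference of the two sides is convex in \<open>s\<close>, so for \<open>s \<le> t\<close> it
  suffices to compare at \<open>s = 1\<close> and \<open>s = t\<close>. Equality holds for \<open>s = t = sqrt 2\<close>.\<close>

lemma annulus_cosine_bound:
  fixes s t :: real
  assumes "1 \<le> s" "s \<le> sqrt 2" "1 \<le> t" "t \<le> sqrt 2"
  shows "s\<^sup>2 + t\<^sup>2 - 1 \<le> 3/2 * (s * t)"
proof -
  have *: "s\<^sup>2 + t\<^sup>2 - 1 \<le> 3/2 * (s * t)" if "1 \<le> s" "s \<le> t" "t \<le> sqrt 2" for s t :: real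
  proof -
    have t2: "t\<^sup>2 \<le> 2" using that power_mono[of t "sqrt 2" 2] by simp
    have "t < 2" using that sqrt2_less_2 by linarith
    have "(s - 1) * (s - t) \<le> 0" using that by (simp add: mult_nonneg_nonpos)
    moreover have "s * (1 - t/2) \<le> t * (1 - t/2)" using that \<open>t < 2\<close> by (intro mult_right_mono) auto
    ultimately show ?thesis using t2 by (simp add: algebra_simps power2_eq_square)
  qed
  show ?thesis
    using *[of s t] *[of t s] assms by (cases "s \<le> t") (auto simp: algebra_simps)
qed

lemma norm_diff_sq: "(cmod (a - b))\<^sup>2 = (cmod a)\<^sup>2 + (cmod b)\<^sup>2 - 2 * Re (a * cnj b)"
  by (simp only: cmod_power2) (simp add: algebra_simps power2_eq_square)

text \<open>The arguments \<open>s\<close> and \<open>t\<close> need not be normalised: the same lemma is used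
  for angles at both ends of \<open>[0, 2 \<pi>]\<close>.\<close>

lemma directions_separated:
  assumes "1 \<le> cmod a" "cmod a \<le> sqrt 2" "1 \<le> cmod b" "cmod b \<le> sqrt 2" "1 \<le> cmod (a - b)"
    and a: "a = of_real (cmod a) * cis s" and b: "b = of_real (cmod b) * cis t"
  shows "sep_angle < \<bar>s - t\<bar>"
proof (rule ccontr)
  assume "\<not> ?thesis"
  then have "cos sep_angle \<le> cos \<bar>s - t\<bar>"
    by (intro cos_monotone_0_pi_le) (auto simp: sep_angle_def)
  then have c: "cos (s - t) > 3/4" using cos_sep_angle by simp
  have "Re (a * cnj b) = cmod a * cmod b * cos (s - t)"
    by (subst a, subst b) (simp add: cos_diff algebra_simps)
  moreover have "cmod a * cmod b > 0" using assms by (intro mult_pos_pos) linarith+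
  ultimately have "Re (a * cnj b) > cmod a * cmod b * (3/4)"
    using c mult_strict_left_mono by metis
  moreover have "1 \<le> (cmod (a - b))\<^sup>2" using assms by simp
  ultimately show False
    using annulus_cosine_bound[OF assms(1-4)] norm_diff_sq[of a b] by (simp add: algebra_simps)
qed

text \<open>The angle, in \<open>[0, 2 \<pi>)\<close>, by which the ray from \<open>p\<close> through \<open>x\<close> has to be turned
  counterclockwise to pass through \<open>z\<close>.\<close>

definition ccw :: "complex \<Rightarrow> complex \<Rightarrow> complex \<Rightarrow> real" where
  "ccw p x z = Arg2pi ((z - p) / (x - p))"

lemma ccw_range: "0 \<le> ccw p x z" "ccw p x z < 2 * pi"
  by (auto simp: ccw_def Arg2pi_ge_0 Arg2pi_lt_2pi)

lemma Arg2pi_cis: "z = of_real (cmod z) * cis (Arg2pi z)"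
  using Arg2pi_eq[of z] by (simp add: cis_conv_exp)

lemma ccw_polar:
  assumes "x \<noteq> p"
  shows "z - p = of_real (cmod (z - p)) * cis (Arg2pi (x - p) + ccw p x z)"
proof -
  let ?w = "(z - p) / (x - p)"
  have "z - p = (x - p) * ?w" using assms by simp
  also have "\<dots> = (of_real (cmod (x - p)) * cis (Arg2pi (x - p))) * (of_real (cmod ?w) * cis (Arg2pi ?w))"
    using Arg2pi_cis[of "x - p"] Arg2pi_cis[of ?w] by metis
  also have "\<dots> = of_real (cmod (x - p) * cmod ?w) * cis (Arg2pi (x - p) + ccw p x z)"
    by (simp add: cis_mult ccw_def mult_ac)
  also have "cmod (x - p) * cmod ?w = cmod (z - p)"
    using assms by (simp add: norm_divide)
  finally show ?thesis .
qed

lemma ccw_self: "x \<noteq> p \<Longrightarrow> ccw p x x = 0"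
  by (simp add: ccw_def Arg2pi_eq_0)

lemma nbrs_separated:
  assumes X: "hard_core X" "p \<in> X" and z: "z \<in> nbrs X p" "z' \<in> nbrs X p" "z \<noteq> z'"
    and lift: "z - p = of_real (cmod (z - p)) * cis s" "z' - p = of_real (cmod (z' - p)) * cis t"
  shows "sep_angle < \<bar>s - t\<bar>"
proof (rule directions_separated[OF _ _ _ _ _ lift])
  show "1 \<le> cmod ((z - p) - (z' - p))"
    using X z by (auto simp: hard_core_def nbrs_def dist_norm)
qed (use nbrsD[OF X z(1)] nbrsD[OF X z(2)] in auto)

lemma ccw_separated:
  assumes X: "hard_core X" "p \<in> X" and z: "z \<in> nbrs X p" "z' \<in> nbrs X p" "z \<noteq> z'" and "x \<noteq> p"
  shows "sep_angle < \<bar>ccw p x z - ccw p x z'\<bar>"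
  using nbrs_separated[OF X z ccw_polar ccw_polar, OF \<open>x \<noteq> p\<close> \<open>x \<noteq> p\<close>] by simp

lemma ccw_separated_ref:
  assumes X: "hard_core X" "p \<in> X" and z: "z \<in> nbrs X p" "x \<in> nbrs X p" "z \<noteq> x"
  shows "sep_angle < ccw p x z" "ccw p x z < 2 * pi - sep_angle"
proof -
  have xp: "x \<noteq> p" using z by (auto simp: nbrs_def)
  show "sep_angle < ccw p x z"
    using ccw_separated[OF X z xp] ccw_self[OF xp] ccw_range(1)[of p x z] by simp
  \<comment> \<open>the reference direction counts as angle 0 and as angle \<open>2 \<pi>\<close>\<close>
  have "x - p = of_real (cmod (x - p)) * cis (Arg2pi (x - p) + 2 * pi)"
    by (simp add: Arg2pi_cis flip: cis_mult)
  from nbrs_separated[OF X z ccw_polar[OF xp] this] ccw_range(2)[of p x z]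
  show "ccw p x z < 2 * pi - sep_angle" by simp
qed

text \<open>Since \<open>d < \<bar>s - t\<bar>\<close> is assumed without a uniform margin, strictness of the conclusion
  rests on there being at least one gap, hence \<open>1 \<le> n\<close>.\<close>

lemma separated_reals_span:
  fixes S :: "real set"
  assumes "1 \<le> n" "card S = Suc n" "S \<subseteq> {lo..hi}" "\<And>s t. s \<in> S \<Longrightarrow> t \<in> S \<Longrightarrow> s \<noteq> t \<Longrightarrow> d < \<bar>s - t\<bar>"
  shows "real n * d < hi - lo"
  using assms
proof (induction n arbitrary: S hi rule: nat_induct_at_least)
  case base
  then obtain s t where "S = {s, t}" "s \<noteq> t" using card_2_iff[of S] by auto
  with base(2) base(3)[of s t] show ?case by auto
next
  case (Suc n)
  have fin: "finite S" "S \<noteq> {}" using Suc.prems(1) card.infinite by fastforce+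
  let ?m = "Max S"
  have m: "?m \<in> S" using fin by simp
  have "real n * d < (?m - d) - lo"
  proof (rule Suc.IH)
    show "card (S - {?m}) = Suc n" using Suc.prems(1) m fin by simp
    show "S - {?m} \<subseteq> {lo..?m - d}"
    proof
      fix s assume s: "s \<in> S - {?m}"
      then have "s \<le> ?m" "d < \<bar>s - ?m\<bar>" using fin m Suc.prems(3)[of s ?m] by auto
      then show "s \<in> {lo..?m - d}" using s Suc.prems(2) by auto
    qed
  qed (use Suc.prems(3) in auto)
  moreover have "?m \<le> hi" using m Suc.prems(2) by auto
  ultimately show ?case by (simp add: algebra_simps)
qed

lemma inj_on_ccw:
  assumes X: "hard_core X" "p \<in> X" and "x \<noteq> p" "T \<subseteq> nbrs X p"
  shows "inj_on (ccw p x) T"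
  using ccw_separated[OF X _ _ _ \<open>x \<noteq> p\<close>] assms(4) sep_angle_pos by (force simp: inj_on_def)

text \<open>Relative to the direction of one of nine neighbors, the other eight would have angles in an interval of
  length \<open>2 \<pi> - 2 \<cdot> 11 \<pi> / 48\<close>, which is less than seven times \<open>11 \<pi> / 48\<close>.\<close>

lemma nbrs_finite_card_le_8:
  assumes X: "hard_core X" "p \<in> X"
  shows "finite (nbrs X p)" "card (nbrs X p) \<le> 8"
proof -
  have no9: False if T: "T \<subseteq> nbrs X p" "finite T" "card T = 9" for T
  proof -
    obtain x where x: "x \<in> T" using T by fastforce
    then have xN: "x \<in> nbrs X p" and xp: "x \<noteq> p" using T by (auto simp: nbrs_def)
    let ?S = "ccw p x ` (T - {x})"
    have "card ?S = Suc 7"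
      using T x inj_on_ccw[OF X xp, of "T - {x}"] by (subst card_image) auto
    moreover have "?S \<subseteq> {sep_angle..2 * pi - sep_angle}"
      using ccw_separated_ref[OF X _ xN] T by (force simp: less_imp_le)
    moreover have "sep_angle < \<bar>s - t\<bar>" if "s \<in> ?S" "t \<in> ?S" "s \<noteq> t" for s t
      using that T ccw_separated[OF X _ _ _ xp] by blast
    ultimately have "real 7 * sep_angle < 2 * pi - sep_angle - sep_angle"
      by (intro separated_reals_span) auto
    then show False using pi_gt_zero by (simp add: sep_angle_def)
  qed
  show "finite (nbrs X p)" using no9 infinite_arbitrarily_large by metis
  show "card (nbrs X p) \<le> 8"
    using no9 obtain_subset_with_card_n[of 9 "nbrs X p"] by (metis not_less_eq_eq Suc_eq_numeral pred_numeral_simps(3))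
qed

text \<open>The seven neighbors other than \<open>x\<close> leave six gaps between the angles \<open>C\<close> and \<open>2 \<pi> - B\<close>.\<close>

lemma angles_at_full_vertex:
  assumes X: "hard_core X" "p \<in> X" and x: "x \<in> nbrs X p" and full: "card (nbrs X p) = 8"
    and C: "\<And>z. z \<in> nbrs X p - {x} \<Longrightarrow> C \<le> ccw p x z"
    and B: "\<And>z. z \<in> nbrs X p - {x} \<Longrightarrow> ccw p x z \<le> 2 * pi - B"
  shows "B + C < 5 * pi / 8"
proof -
  have xp: "x \<noteq> p" using x by (auto simp: nbrs_def)
  let ?S = "ccw p x ` (nbrs X p - {x})"
  have "card ?S = Suc 6"
    using x full inj_on_ccw[OF X xp, of "nbrs X p - {x}"] by (subst card_image) auto
  moreover have "?S \<subseteq> {C..2 * pi - B}" using B C by force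
  moreover have "sep_angle < \<bar>s - t\<bar>" if "s \<in> ?S" "t \<in> ?S" "s \<noteq> t" for s t
    using that ccw_separated[OF X _ _ _ xp] by blast
  ultimately have "real 6 * sep_angle < 2 * pi - B - C"
    by (intro separated_reals_span) auto
  then show ?thesis by (simp add: sep_angle_def)
qed

section \<open>Crossing edges span a unit square\<close>

text \<open>For \<open>s, t > 0\<close> and \<open>s + t > 1\<close> the points \<open>0, a, c, b\<close> are the corners of a
  (possibly degenerate) convex quadrilateral, whose diagonals are \<open>c\<close> and \<open>a - b\<close>. As its sides are at least 1 and its diagonals at most
  \<open>sqrt 2\<close>, no angle is obtuse; as the angles add up to \<open>2 \<pi>\<close>, all are right angles. In terms of \<open>P = a \<bullet> a\<close>, \<open>Q = b \<bullet> b\<close>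
  and \<open>g = a \<bullet> b\<close> this is an elementary computation.\<close>

lemma crossing_edges_unit_square:
  fixes a b :: complex and s t :: real
  defines "c \<equiv> of_real s * a + of_real t * b"
  assumes "1 \<le> cmod a" "1 \<le> cmod b" "1 \<le> cmod (c - a)" "1 \<le> cmod (c - b)"
    and "cmod c \<le> sqrt 2" "cmod (a - b) \<le> sqrt 2"
    and s: "0 < s" and t: "0 < t" and st: "1 < s + t"
  shows "cmod a = 1" "cmod b = 1" "Re (a * cnj b) = 0" "c = a + b"
proof -
  define P Q g where "P = (cmod a)\<^sup>2" "Q = (cmod b)\<^sup>2" "g = Re (a * cnj b)"
  note PQg = this
  have P: "1 \<le> P" and Q: "1 \<le> Q" using assms by (auto simp: PQg)
  have diag: "(cmod c)\<^sup>2 \<le> 2" "(cmod (a - b))\<^sup>2 \<le> 2"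
    using assms power_mono[of "cmod c" "sqrt 2" 2] power_mono[of "cmod (a - b)" "sqrt 2" 2] by auto
  have side: "1 \<le> (cmod (c - a))\<^sup>2" "1 \<le> (cmod (c - b))\<^sup>2" using assms by auto
  have cc: "(cmod c)\<^sup>2 = s\<^sup>2 * P + t\<^sup>2 * Q + 2 * s * t * g"
    unfolding c_def PQg by (simp only: cmod_power2) (simp add: algebra_simps power2_eq_square)
  have ca: "(cmod (c - a))\<^sup>2 = (s - 1)\<^sup>2 * P + t\<^sup>2 * Q + 2 * (s - 1) * t * g"
    unfolding c_def PQg by (simp only: cmod_power2) (simp add: algebra_simps power2_eq_square)
  have cb: "(cmod (c - b))\<^sup>2 = s\<^sup>2 * P + (t - 1)\<^sup>2 * Q + 2 * s * (t - 1) * g"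
    unfolding c_def PQg by (simp only: cmod_power2) (simp add: algebra_simps power2_eq_square)
  have ab: "(cmod (a - b))\<^sup>2 = P + Q - 2 * g"
    unfolding PQg by (rule norm_diff_sq)
  have g: "0 \<le> g" using ab P Q diag(2) by linarith
  \<comment> \<open>the angles at the corners \<open>a\<close>, \<open>b\<close> and \<open>c\<close> are not obtuse\<close>
  have at_a: "t * g \<le> (1 - s) * P"
    using cc ca P diag side by (simp add: algebra_simps power2_eq_square)
  have at_b: "s * g \<le> (1 - t) * Q"
    using cc cb Q diag side by (simp add: algebra_simps power2_eq_square)
  have at_c: "s * (1 - s) * P + t * (1 - t) * Q \<le> (1 - s) * (1 - t) * g + s * t * g"
    using ab ca cb diag side by (simp add: algebra_simps power2_eq_square)
  have s1: "s \<le> 1"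
  proof (rule ccontr)
    assume "\<not> s \<le> 1"
    then have "(1 - s) * P < 0" using P by (simp add: mult_neg_pos)
    moreover have "0 \<le> t * g" using t g by simp
    ultimately show False using at_a by simp
  qed
  have t1: "t \<le> 1"
  proof (rule ccontr)
    assume "\<not> t \<le> 1"
    then have "(1 - t) * Q < 0" using Q by (simp add: mult_neg_pos)
    moreover have "0 \<le> s * g" using s g by simp
    ultimately show False using at_b by simp
  qed
  have "s * (t * g) \<le> s * ((1 - s) * P)" "t * (s * g) \<le> t * ((1 - t) * Q)"
    using at_a at_b s t by (auto intro!: mult_left_mono)
  with at_c have "s * t * g \<le> (1 - s) * (1 - t) * g"
    by (simp add: algebra_simps)
  then have "(s + t - 1) * g \<le> 0" by (simp add: algebra_simps)
  with st g have g0: "g = 0" by (smt (verit) mult_pos_pos)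
  have "0 \<le> s * (1 - s) * P" "0 \<le> t * (1 - t) * Q" using s s1 t t1 P Q by auto
  moreover have "s * (1 - s) * P + t * (1 - t) * Q \<le> 0" using at_c g0 by simp
  ultimately have "s * (1 - s) * P = 0" "t * (1 - t) * Q = 0" by linarith+
  with s t P Q have [simp]: "s = 1" "t = 1" by auto
  show "c = a + b" by (simp add: c_def)
  show "Re (a * cnj b) = 0" using g0 by (simp add: PQg)
  have "P = 1" "Q = 1" using cc g0 diag P Q by auto
  then show "cmod a = 1" "cmod b = 1" using norm_ge_zero[of a] norm_ge_zero[of b]
    by (auto simp: PQg power2_eq_1_iff)
qed

text \<open>The sector is the closed cone at \<open>x\<close> spanned by \<open>p\<close> and \<open>q\<close>. Describing it by nonnegative
  coefficients instead of angles makes the notion symmetric in \<open>p\<close> and \<open>q\<close>.\<close>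

definition empty_sector :: "complex set \<Rightarrow> complex \<Rightarrow> complex \<Rightarrow> complex \<Rightarrow> bool" where
  "empty_sector X x p q \<longleftrightarrow> (\<forall>z\<in>nbrs X x. \<forall>l\<ge>0. \<forall>m\<ge>0.
     z - x = of_real l * (p - x) + of_real m * (q - x) \<longrightarrow> z = p \<or> z = q)"

lemma empty_sector_commute: "empty_sector X x p q \<longleftrightarrow> empty_sector X x q p"
  unfolding empty_sector_def by (metis add.commute)

lemma real_combination_unique:
  assumes "Im (cnj a * b) \<noteq> 0" "of_real s * a + of_real t * b = 0"
  shows "s = 0" "t = 0"
proof -
  have e: "s * Re a + t * Re b = 0" "s * Im a + t * Im b = 0"
    using assms(2) by (auto simp: complex_eq_iff)
  have "Re a * (s * Im a + t * Im b) - Im a * (s * Re a + t * Re b) = t * Im (cnj a * b)"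
       "Im b * (s * Re a + t * Re b) - Re b * (s * Im a + t * Im b) = s * Im (cnj a * b)"
    by (simp_all add: algebra_simps)
  then show "s = 0" "t = 0" using e assms(1) by auto
qed

text \<open>A neighbor \<open>z\<close> of \<open>p\<close> that is seen from \<open>p\<close> strictly between \<open>x\<close> and \<open>q\<close> lies beyond the
  line through \<open>x\<close> and \<open>q\<close>. Otherwise it would be in the triangle \<open>x p q\<close>, hence at distance at most
  \<open>sqrt 2\<close> from \<open>x\<close>, and thus a neighbor of \<open>x\<close> in the empty sector. So the edge from \<open>p\<close>
  to \<open>z\<close> crosses the one from \<open>x\<close> to \<open>q\<close>.\<close>

lemma nbr_across_empty_sector:
  assumes X: "hard_core X" "x \<in> X" and p: "p \<in> nbrs X x" and q: "q \<in> nbrs X x"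
    and nc: "Im (cnj (p - x) * (q - x)) \<noteq> 0"
    and empty: "empty_sector X x p q"
    and z: "z \<in> nbrs X p" "z - p = of_real s * (x - p) + of_real t * (q - p)"
    and s: "0 < s" and t: "0 < t"
  shows "cmod (p - x) = 1" "cmod (q - p) = 1" "Re ((p - x) * cnj (q - p)) = 0" "z = x + (q - p)"
proof -
  have pX: "p \<in> X" using nbrsD[OF X p] by simp
  have zX: "z \<in> X" and zp: "z \<noteq> p" using z by (auto simp: nbrs_def)
  have zx: "z - x = of_real (1 - s - t) * (p - x) + of_real t * (q - x)"
    using z(2) by (simp add: algebra_simps)
  have qp: "q \<noteq> p"
    using nc by (auto simp: algebra_simps)
  have xz: "x \<noteq> z" using zx real_combination_unique(2)[OF nc, of "1 - s - t" t] t by auto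
  have zq: "z \<noteq> q"
  proof
    assume "z = q"
    then have "of_real (1 - s - t) * (p - x) + of_real (t - 1) * (q - x) = 0"
      using zx by (simp add: algebra_simps)
    from real_combination_unique[OF nc this] s show False by auto
  qed
  have st: "1 < s + t"
  proof (rule ccontr)
    assume "\<not> 1 < s + t"
    then have l: "0 \<le> 1 - s - t" by simp
    have "cmod (z - x) \<le> (1 - s - t) * cmod (p - x) + t * cmod (q - x)"
      unfolding zx using l t norm_triangle_ineq[of "of_real (1 - s - t) * (p - x)" "of_real t * (q - x)"]
      by (simp only: norm_mult norm_of_real abs_of_nonneg)
    also have "\<dots> \<le> (1 - s - t) * sqrt 2 + t * sqrt 2"
      using l t nbrsD[OF X p] nbrsD[OF X q] by (intro add_mono mult_left_mono) auto
    also have "\<dots> = (1 - s) * sqrt 2" by (simp add: algebra_simps)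
    also have "\<dots> \<le> 1 * sqrt 2" using s by (intro mult_right_mono) auto
    finally have "z \<in> nbrs X x" using zX xz by (auto simp: nbrs_def dist_norm norm_minus_commute)
    with empty zx l t zp zq show False
      unfolding empty_sector_def by (meson less_imp_le)
  qed
  have c: "of_real s * (x - p) + of_real t * (q - p) = z - p" using z by simp
  have hc: "1 \<le> cmod (u - v)" if "u \<in> X" "v \<in> X" "u \<noteq> v" for u v
    using X that by (auto simp: hard_core_def dist_norm)
  have qX: "q \<in> X" using nbrsD[OF X q] by simp
  have xp: "x \<noteq> p" using p by (auto simp: nbrs_def)
  have "cmod (x - p) = 1 \<and> cmod (q - p) = 1 \<and> Re ((x - p) * cnj (q - p)) = 0
    \<and> z - p = (x - p) + (q - p)"
    using crossing_edges_unit_square[of "x - p" "q - p" s t, unfolded c]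
      hc[OF X(2) pX xp] hc[OF qX pX qp] hc[OF zX X(2)] hc[OF zX qX] xz zq
      nbrsD[OF X(1) pX z(1)] nbrsD[OF X q] s t st by (auto simp: norm_minus_commute)
  then show "cmod (p - x) = 1" "cmod (q - p) = 1" "Re ((p - x) * cnj (q - p)) = 0" "z = x + (q - p)"
    by (auto simp: norm_minus_commute algebra_simps)
qed

section \<open>Angles of the triangle under a sector\<close>

lemma Arg2pi_between_combination:
  assumes "0 < Arg2pi w" "Arg2pi w < Arg2pi v" "Arg2pi v < pi"
  obtains s t :: real where "0 < s" "0 < t" "w = of_real s + of_real t * v"
proof -
  have nz: "w \<noteq> 0" "v \<noteq> 0" using assms by auto
  have ImV: "Im v > 0" and ImW: "Im w > 0" using assms Arg2pi_lt_pi[of v] Arg2pi_lt_pi[of w] by auto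
  have "0 < Arg2pi v - Arg2pi w" "Arg2pi v - Arg2pi w < pi" using assms by auto
  moreover have "Arg2pi (v / w) = Arg2pi v - Arg2pi w" using nz assms by (intro Arg2pi_divide) auto
  ultimately have "0 < Im (v / w)" using Arg2pi_lt_pi by metis
  then have *: "0 < Im v * Re w - Re v * Im w"
    by (auto simp: Im_divide zero_less_divide_iff sum_power2_gt_zero_iff not_sum_power2_lt_zero)
  show thesis
  proof
    show "0 < (Im v * Re w - Re v * Im w) / Im v" "0 < Im w / Im v" using * ImV ImW by auto
    show "w = of_real ((Im v * Re w - Re v * Im w) / Im v) + of_real (Im w / Im v) * v"
      using ImV by (auto simp: complex_eq_iff field_simps)
  qed
qed

text \<open>The product of the three quotients is \<open>-1\<close>, so the angles add up to \<open>\<pi>\<close> modulo \<open>2 \<pi>\<close>; each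
  lies between \<open>0\<close> and \<open>\<pi>\<close>.\<close>

lemma triangle_angle_sum:
  assumes "0 < Im ((q - x) / (p - x))"
  shows "0 < Im ((x - p) / (q - p))" "0 < Im ((p - q) / (x - q))"
    "Arg2pi ((q - x) / (p - x)) + Arg2pi ((x - p) / (q - p)) + Arg2pi ((p - q) / (x - q)) = pi"
proof -
  let ?u = "(q - x) / (p - x)" and ?v = "(x - p) / (q - p)" and ?w = "(p - q) / (x - q)"
  have ne: "p \<noteq> x" "q \<noteq> x" using assms by auto
  have pq: "p \<noteq> q" using assms ne by auto
  have sq: "0 < Im (cnj (p - x) * (q - x))"
    using assms by (auto simp: Im_divide zero_less_divide_iff not_sum_power2_lt_zero algebra_simps)
  show v: "0 < Im ?v" and w: "0 < Im ?w"
    using sq pq ne by (auto simp: Im_divide zero_less_divide_iff not_sum_power2_lt_zero sum_power2_gt_zero_iff complex_eq_iff algebra_simps)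
  have "(q - x) * (x - p) * (p - q) = - ((p - x) * (q - p) * (x - q))" by algebra
  then have prod: "?u * ?v * ?w = -1" using ne pq by (simp add: divide_eq_eq)
  have r: "0 < Arg2pi ?u" "Arg2pi ?u < pi" "0 < Arg2pi ?v" "Arg2pi ?v < pi" "0 < Arg2pi ?w" "Arg2pi ?w < pi"
    using assms v w Arg2pi_lt_pi[of ?u] Arg2pi_lt_pi[of ?v] Arg2pi_lt_pi[of ?w] by auto
  have nz: "?u \<noteq> 0" "?v \<noteq> 0" "?w \<noteq> 0" using ne pq by auto
  have "Arg2pi (-1) = pi" using Arg2pi_of_real[of "-1"] by simp
  then show "Arg2pi ?u + Arg2pi ?v + Arg2pi ?w = pi"
    using Arg2pi_times[of "?u * ?v" ?w] Arg2pi_times[of ?u ?v] r nz prod by (auto split: if_splits)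
qed

text \<open>The neighbors \<open>p\<close> and \<open>q\<close>, in counterclockwise order, are two corners of a unit square with
  corner \<open>x\<close>, one of them opposite to \<open>x\<close>. The first case has \<open>q\<close> opposite to \<open>x\<close>, the second \<open>p\<close>;
  the factors \<open>1 + \<i>\<close> and \<open>1 - \<i>\<close> turn a side into the diagonal to its left or right.\<close>

definition square_sector :: "complex \<Rightarrow> complex \<Rightarrow> complex \<Rightarrow> bool" where
  "square_sector x p q \<longleftrightarrow>
     cmod (p - x) = 1 \<and> q - x = (1 + \<i>) * (p - x) \<or>
     cmod (q - x) = 1 \<and> p - x = (1 - \<i>) * (q - x)"

lemma Arg2pi_eighths:
  "Arg2pi (1 + \<i>) = pi / 4" "Arg2pi (1 - \<i>) = 2 * pi - pi / 4"
proof -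
  show 1: "Arg2pi (1 + \<i>) = pi / 4"
    by (simp add: Arg2pi_arctan_upperhalf arctan_one)
  have "Arg2pi (cnj (1 + \<i>)) = 2 * pi - pi / 4"
    unfolding Arg2pi_cnj 1 by (simp add: complex_is_Real_iff)
  then show "Arg2pi (1 - \<i>) = 2 * pi - pi / 4" by simp
qed

text \<open>A neighbor strictly between the directions of \<open>x\<close> and \<open>w\<close> would make an angle larger than \<open>11 \<pi> / 48\<close>
  with each of them; but the two angles add up to \<open>\<pi>/4\<close>.\<close>

lemma no_nbr_within_eighth:
  assumes X: "hard_core X" "p \<in> X" and x: "x \<in> nbrs X p" and w: "w \<in> nbrs X p"
    and z: "z \<in> nbrs X p - {x}"
  shows "ccw p x w = pi / 4 \<Longrightarrow> pi / 4 \<le> ccw p x z"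
    and "ccw p x w = 2 * pi - pi / 4 \<Longrightarrow> ccw p x z \<le> 2 * pi - pi / 4"
proof -
  have xp: "x \<noteq> p" using x by (auto simp: nbrs_def)
  have *: "z = w \<or> sep_angle < \<bar>ccw p x z - ccw p x w\<bar>"
    "sep_angle < ccw p x z" "ccw p x z < 2 * pi - sep_angle"
    using ccw_separated[OF X _ w _ xp] ccw_separated_ref[OF X _ x] z by auto
  show "ccw p x w = pi / 4 \<Longrightarrow> pi / 4 \<le> ccw p x z"
    "ccw p x w = 2 * pi - pi / 4 \<Longrightarrow> ccw p x z \<le> 2 * pi - pi / 4"
    using * pi_gt_zero by (auto simp: sep_angle_def abs_if split: if_splits)
qed

lemma square_corner:
  assumes "x \<noteq> p" "z - p = w * (x - p)"
  shows "ccw p x z = Arg2pi w"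
  using assms by (simp add: ccw_def)

lemma orthogonal_unit:
  assumes "cmod v = 1" "cmod w = 1" "Re (v * cnj w) = 0"
  shows "w = \<i> * v \<or> w = - \<i> * v"
proof -
  have v: "v * cnj v = 1" using assms(1) complex_norm_square[of v] by simp
  have "(cmod (v * cnj w))\<^sup>2 = 1" using assms(1,2) by (simp add: norm_mult)
  then have "(Re (v * cnj w))\<^sup>2 + (Im (v * cnj w))\<^sup>2 = 1" by (simp only: cmod_power2)
  then have "Im (v * cnj w) = 1 \<or> Im (v * cnj w) = -1"
    using assms(3) by (simp add: power2_eq_1_iff)
  then have "v * cnj w = \<i> \<or> v * cnj w = - \<i>"
    using assms(3) by (auto simp: complex_eq_iff)
  then have "cnj v * w = - \<i> \<or> cnj v * w = \<i>"
    by (metis complex_cnj_cnj complex_cnj_i complex_cnj_minus complex_cnj_mult)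
  then have "v * (cnj v * w) = v * (- \<i>) \<or> v * (cnj v * w) = v * \<i>" by auto
  then show ?thesis using v by (auto simp: mult.assoc[symmetric] mult.commute)
qed

text \<open>The fourth corner of the square, which is \<open>x + \<i> * (p - x)\<close> or \<open>x - \<i> * (q - x)\<close>, is assumed to belong
  to the configuration. At each of the two corners \<open>p\<close> and \<open>q\<close> there is then a neighbor whose direction makes an
  angle \<open>\<pi>/4\<close> with that of \<open>x\<close>.\<close>

lemma square_sector_angles:
  assumes X: "hard_core X" "x \<in> X" and p: "p \<in> nbrs X x" and q: "q \<in> nbrs X x"
    and sq: "cmod (p - x) = 1 \<and> q - x = (1 + \<i>) * (p - x) \<and> x + \<i> * (p - x) \<in> nbrs X p \<or>
       cmod (q - x) = 1 \<and> p - x = (1 - \<i>) * (q - x) \<and> x - \<i> * (q - x) \<in> nbrs X q"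
  shows "square_sector x p q" "ccw x p q = pi / 4"
    "\<And>z. z \<in> nbrs X p - {x} \<Longrightarrow> ccw p x z \<le> 2 * pi - pi / 4"
    "\<And>z. z \<in> nbrs X q - {x} \<Longrightarrow> pi / 4 \<le> ccw q x z"
proof -
  have pX: "p \<in> X" "p \<noteq> x" and qX: "q \<in> X" "q \<noteq> x" using nbrsD[OF X p] nbrsD[OF X q] by auto
  have xp: "x \<in> nbrs X p" and xq: "x \<in> nbrs X q" using p q X nbrs_sym by auto
  show "square_sector x p q" using sq by (auto simp: square_sector_def)
  have half: "Arg2pi ((1 + \<i>) / 2) = pi / 4" "Arg2pi ((1 - \<i>) / 2) = 2 * pi - pi / 4"
    using Arg2pi_divide_of_real[of 2 "1 + \<i>"] Arg2pi_divide_of_real[of 2 "1 - \<i>"]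
    by (simp_all add: Arg2pi_eighths)
  have "q - p = \<i> * (p - x) \<and> cmod (p - x) = 1 \<or> q - p = \<i> * (q - x) \<and> cmod (q - x) = 1"
    using sq by (auto simp: algebra_simps)
  then have "cmod (q - p) = 1" by (metis mult_1 norm_ii norm_mult)
  then have qp: "q \<in> nbrs X p" "p \<in> nbrs X q" using pX qX
    by (auto simp: nbrs_def dist_norm norm_minus_commute[of p q])
  from sq have "ccw x p q = pi / 4 \<and> (\<exists>z\<in>nbrs X p. ccw p x z = 2 * pi - pi / 4)
      \<and> (\<exists>z\<in>nbrs X q. ccw q x z = pi / 4)"
  proof (elim disjE conjE)
    assume v: "q - x = (1 + \<i>) * (p - x)" and z: "x + \<i> * (p - x) \<in> nbrs X p"
    have "ccw x p q = pi / 4" using square_corner[OF pX(2) v] Arg2pi_eighths by simp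
    moreover have "ccw p x (x + \<i> * (p - x)) = 2 * pi - pi / 4"
      using square_corner[of x p "x + \<i> * (p - x)" "1 - \<i>"] pX Arg2pi_eighths
      by (simp add: algebra_simps)
    moreover have pq: "p - q = (1 + \<i>) / 2 * (x - q)"
    proof -
      have "x - q = - ((1 + \<i>) * (p - x))" "p - q = - \<i> * (p - x)" 
        using v by (simp_all add: algebra_simps)
      moreover have "(1 + \<i>) / 2 * (1 + \<i>) = \<i>" by (simp add: complex_eq_iff)
      ultimately show ?thesis by (metis (no_types) minus_mult_left minus_mult_right mult.assoc)
    qed
    have "ccw q x p = pi / 4" using square_corner[OF qX(2)[symmetric] pq] half(1) by simp
    ultimately show ?thesis using z qp by blast
  next
    assume v: "p - x = (1 - \<i>) * (q - x)" and z: "x - \<i> * (q - x) \<in> nbrs X q"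
    have "(1 + \<i>) / 2 * (1 - \<i>) = 1" by (simp add: complex_eq_iff)
    then have "q - x = (1 + \<i>) / 2 * (p - x)" unfolding v by (metis mult.assoc mult_1)
    from square_corner[OF pX(2) this] have "ccw x p q = pi / 4" using half(1) by simp
    moreover have "ccw q x (x - \<i> * (q - x)) = pi / 4"
      using square_corner[of x q "x - \<i> * (q - x)" "1 + \<i>"] qX Arg2pi_eighths
      by (simp add: algebra_simps)
    moreover have qp': "q - p = (1 - \<i>) / 2 * (x - p)"
    proof -
      have "x - p = - ((1 - \<i>) * (q - x))" "q - p = \<i> * (q - x)" 
        using v by (simp_all add: algebra_simps)
      moreover have "(1 - \<i>) / 2 * (1 - \<i>) = - \<i>" by (simp add: complex_eq_iff)
      ultimately show ?thesis by (metis (no_types) minus_mult_left minus_mult_right mult.assoc minus_minus)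
    qed
    have "ccw p x q = 2 * pi - pi / 4" using square_corner[OF pX(2)[symmetric] qp'] half(2) by simp
    ultimately show ?thesis using z qp by blast
  qed
  then obtain z1 z2 where z: "z1 \<in> nbrs X p" "ccw p x z1 = 2 * pi - pi / 4"
    "z2 \<in> nbrs X q" "ccw q x z2 = pi / 4" and "ccw x p q = pi / 4" by blast
  then show "ccw x p q = pi / 4" by simp
  show "ccw p x z \<le> 2 * pi - pi / 4" if "z \<in> nbrs X p - {x}" for z
    using no_nbr_within_eighth(2)[OF X(1) pX(1) xp z(1) that z(2)] .
  show "pi / 4 \<le> ccw q x z" if "z \<in> nbrs X q - {x}" for z
    using no_nbr_within_eighth(1)[OF X(1) qX(1) xq z(3) that z(4)] .
qed

text \<open>The angle of \<open>q\<close> relative to \<open>x\<close>, seen from \<open>p\<close>, is measured clockwise, which is why the bound \<open>B\<close>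
  is subtracted from \<open>2 \<pi>\<close>. In the generic case \<open>B\<close> and \<open>C\<close> are the angles of the triangle
  \<open>x p q\<close> at \<open>p\<close> and \<open>q\<close>. A neighbor of \<open>p\<close> or of \<open>q\<close> that violates these bounds lies across the edge opposite,
  and so it completes a unit square.\<close>

lemma sector_angles:
  assumes X: "hard_core X" "x \<in> X" and p: "p \<in> nbrs X x" and q: "q \<in> nbrs X x"
    and theta: "0 < ccw x p q" "ccw x p q < pi" and empty: "empty_sector X x p q"
  obtains B C where
    "\<And>z. z \<in> nbrs X p - {x} \<Longrightarrow> ccw p x z \<le> 2 * pi - B"
    "\<And>z. z \<in> nbrs X q - {x} \<Longrightarrow> C \<le> ccw q x z"
    "ccw x p q + B + C = pi \<or>
     ccw x p q = pi / 4 \<and> B = pi / 4 \<and> C = pi / 4 \<and> square_sector x p q"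
proof -
  let ?B = "Arg2pi ((x - p) / (q - p))" and ?C = "ccw q x p"
  have pX: "p \<in> X" "p \<noteq> x" and qX: "q \<in> X" "q \<noteq> x" using nbrsD[OF X p] nbrsD[OF X q] by auto
  have im: "0 < Im ((q - x) / (p - x))" using theta Arg2pi_lt_pi unfolding ccw_def by blast
  note tri = triangle_angle_sum[OF im]
  have qp: "q \<noteq> p" using tri by auto
  have nc: "Im (cnj (p - x) * (q - x)) \<noteq> 0" "Im (cnj (q - x) * (p - x)) \<noteq> 0"
    using im by (auto simp: Im_divide algebra_simps)
  have bounds: "0 < ?B" "?B < pi" "0 < ?C" "?C < pi"
    using tri(1,2) Arg2pi_lt_pi[of "(x - p) / (q - p)"] Arg2pi_lt_pi[of "(p - q) / (x - q)"]
    by (auto simp: ccw_def)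
  show thesis
  proof (cases "cmod (p - x) = 1 \<and> q - x = (1 + \<i>) * (p - x) \<and> x + \<i> * (p - x) \<in> nbrs X p \<or>
       cmod (q - x) = 1 \<and> p - x = (1 - \<i>) * (q - x) \<and> x - \<i> * (q - x) \<in> nbrs X q")
    case True
    show thesis
      by (rule that[of "pi/4" "pi/4"]) (use square_sector_angles[OF X p q True] in auto)
  next
    case False
    have atp: "ccw p x z \<le> 2 * pi - ?B" if z: "z \<in> nbrs X p - {x}" for z
    proof (rule ccontr)
      assume less: "\<not> ?thesis"
      have zp: "z \<noteq> p" using z by (auto simp: nbrs_def)
      have "Arg2pi ((x - p) / (z - p)) = Arg2pi (inverse ((z - p) / (x - p)))" by simp
      also have "\<dots> = 2 * pi - ccw p x z"
        using less bounds Arg2pi_real[of "(z - p) / (x - p)"]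
        unfolding Arg2pi_inverse ccw_def by (auto split: if_splits)
      finally have w: "Arg2pi (cnj ((z - p) / (x - p))) = 2 * pi - ccw p x z"
        using zp pX Arg2pi_cnj_eq_inverse[of "(z - p) / (x - p)"] by simp
      have v: "Arg2pi (cnj ((q - p) / (x - p))) = ?B"
        using qp pX Arg2pi_cnj_eq_inverse[of "(q - p) / (x - p)"] by simp
      obtain s t where st: "0 < s" "0 < t"
        "cnj ((z - p) / (x - p)) = of_real s + of_real t * cnj ((q - p) / (x - p))"
        by (rule Arg2pi_between_combination[of "cnj ((z - p) / (x - p))" "cnj ((q - p) / (x - p))"])
           (use w v less bounds ccw_range(2)[of p x z] in auto)
      then have "cnj (cnj ((z - p) / (x - p))) = cnj (of_real s + of_real t * cnj ((q - p) / (x - p)))"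
        by simp
      then have "(z - p) / (x - p) = of_real s + of_real t * ((q - p) / (x - p))"
        by (simp only: complex_cnj_cnj complex_cnj_add complex_cnj_mult complex_cnj_complex_of_real)
      then have "z - p = of_real s * (x - p) + of_real t * (q - p)"
        using pX by (simp add: divide_eq_eq distrib_right)
      note n = nbr_across_empty_sector[OF X p q nc(1) empty _ this st(1,2)]
      have "q - p = \<i> * (p - x) \<or> q - p = - \<i> * (p - x)"
        using n z by (intro orthogonal_unit) auto
      moreover have "q - p \<noteq> - \<i> * (p - x)"
      proof
        assume "q - p = - \<i> * (p - x)"
        then have "q - x = (1 - \<i>) * (p - x)" by (simp add: algebra_simps)
        then show False using im pX by simp
      qed
      ultimately have e: "q - p = \<i> * (p - x)" by simp
      then have "q - x = (1 + \<i>) * (p - x)" by (simp add: algebra_simps)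
      moreover have "z = x + \<i> * (p - x)" using n(4) z e by auto
      ultimately show False using False n z by auto
    qed
    have atq: "?C \<le> ccw q x z" if z: "z \<in> nbrs X q - {x}" for z
    proof (rule ccontr)
      assume less: "\<not> ?thesis"
      have "x \<in> nbrs X q" using q X nbrs_sym by auto
      then have pos: "0 < ccw q x z"
        using ccw_separated_ref(1)[OF X(1) qX(1)] z sep_angle_pos by fastforce
      obtain s t where st: "0 < s" "0 < t"
        "(z - q) / (x - q) = of_real s + of_real t * ((p - q) / (x - q))"
        by (rule Arg2pi_between_combination[of "(z - q) / (x - q)" "(p - q) / (x - q)"])
           (use less bounds pos in \<open>auto simp: ccw_def\<close>)
      then have "z - q = of_real s * (x - q) + of_real t * (p - q)"
        using qX by (simp add: divide_eq_eq distrib_right)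
      note n = nbr_across_empty_sector[OF X q p nc(2) _ _ this st(1,2)]
      have e: "empty_sector X x q p" using empty empty_sector_commute by metis
      have "p - q = \<i> * (q - x) \<or> p - q = - \<i> * (q - x)"
        using n e z by (intro orthogonal_unit) auto
      moreover have "p - q \<noteq> \<i> * (q - x)"
      proof
        assume "p - q = \<i> * (q - x)"
        then have "p - x = (1 + \<i>) * (q - x)" by (simp add: algebra_simps)
        then have "(q - x) / (p - x) = 1 / (1 + \<i>)" using qX by simp
        then show False using im by (simp add: Im_divide)
      qed
      ultimately have pq: "p - q = - \<i> * (q - x)" by simp
      then have "p - x = (1 - \<i>) * (q - x)" by (simp add: algebra_simps)
      moreover have "z = x - \<i> * (q - x)" using n(4) e z pq by auto
      ultimately show False using False n e z by auto
    qed
    show thesis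
      by (rule that[of ?B ?C]) (use atp atq tri(3) in \<open>auto simp: ccw_def\<close>)
  qed
qed

section \<open>Cyclic enumeration of the neighbors\<close>

text \<open>The enumeration closes up: index 8 stands for the first neighbor again, with its argument increased
  by \<open>2 \<pi>\<close>, so that all eight sectors have the same form.\<close>

lemma full_vertex_enumeration:
  assumes X: "hard_core X" "x \<in> X" and full: "card (nbrs X x) = 8"
  obtains p :: "nat \<Rightarrow> complex" and t :: "nat \<Rightarrow> real"
  where "p ` {..<8} = nbrs X x" "p 8 = p 0" "t 8 = t 0 + 2 * pi"
    "\<And>i. i \<le> 8 \<Longrightarrow> p i - x = of_real (cmod (p i - x)) * cis (t i)"
    "\<And>i. i < 8 \<Longrightarrow> t i < t (Suc i)"
    "\<And>i. i < 8 \<Longrightarrow> p i \<noteq> p (Suc i)"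
proof -
  let ?N = "nbrs X x" and ?f = "\<lambda>z. Arg2pi (z - x)"
  have fin: "finite ?N" using nbrs_finite_card_le_8[OF X] by simp
  have inj: "inj_on ?f ?N"
  proof (rule inj_onI)
    fix y z assume yz: "y \<in> ?N" "z \<in> ?N" "?f y = ?f z"
    show "y = z"
    proof (rule ccontr)
      assume "y \<noteq> z"
      from nbrs_separated[OF X yz(1,2) this Arg2pi_cis Arg2pi_cis] yz(3) show False
        using sep_angle_pos by simp
    qed
  qed
  define ts where "ts = sorted_list_of_set (?f ` ?N)"
  have len: "length ts = 8" using full card_image[OF inj] by (simp add: ts_def)
  have set: "set ts = ?f ` ?N" using fin by (simp add: ts_def)
  have sorted: "ts ! i < ts ! j" if "i < j" "j < 8" for i j
    using that len strict_sorted_list_of_set[of "?f ` ?N"] sorted_wrt_nth_less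
    unfolding ts_def by metis
  define q where "q i = inv_into ?N ?f (ts ! i)" for i
  have q: "q i \<in> ?N" "?f (q i) = ts ! i" if "i < 8" for i
  proof -
    have "ts ! i \<in> ?f ` ?N" using that set len nth_mem[of i ts] by simp
    then show "q i \<in> ?N" "?f (q i) = ts ! i"
      unfolding q_def by (rule inv_into_into, rule f_inv_into_f)
  qed
  define p where "p i = (if i < 8 then q i else q 0)" for i
  define t where "t i = (if i < 8 then ts ! i else ts ! 0 + 2 * pi)" for i
  show thesis
  proof
    show "p ` {..<8} = nbrs X x"
    proof
      show "p ` {..<8} \<subseteq> nbrs X x" using q by (auto simp: p_def)
      show "nbrs X x \<subseteq> p ` {..<8}"
      proof
        fix z assume z: "z \<in> ?N"
        then obtain i where i: "i < 8" "ts ! i = ?f z" using set len by (metis imageI in_set_conv_nth)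
        then have "p i = z" using inv_into_f_f[OF inj z] by (simp add: p_def q_def)
        with i show "z \<in> p ` {..<8}" by auto
      qed
    qed
    show "p 8 = p 0" "t 8 = t 0 + 2 * pi" by (auto simp: p_def t_def)
    show "p i - x = of_real (cmod (p i - x)) * cis (t i)" if "i \<le> 8" for i
    proof (cases "i < 8")
      case True
      then show ?thesis using Arg2pi_cis[of "q i - x"] q(2)[of i] by (metis p_def t_def)
    next
      case False
      moreover have "cis (ts ! 0 + 2 * pi) = cis (ts ! 0)" by (simp flip: cis_mult)
      ultimately show ?thesis using Arg2pi_cis[of "q 0 - x"] q(2)[of 0]
        by (metis p_def t_def zero_less_numeral)
    qed
    show ti: "t i < t (Suc i)" if "i < 8" for i
    proof (cases "Suc i < 8")
      case True then show ?thesis using sorted by (simp add: t_def)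
    next
      case False
      then have "i = 7" using that by simp
      then show ?thesis using q[of 7] q[of 0] Arg2pi_lt_2pi[of "q 7 - x"] Arg2pi_ge_0[of "q 0 - x"]
        by (simp add: t_def)
    qed
    show "p i \<noteq> p (Suc i)" if "i < 8" for i
    proof (cases "Suc i < 8")
      case True then show ?thesis using sorted[of i "Suc i"] q[of i] q[of "Suc i"] by (auto simp: p_def)
    next
      case False
      then have "i = 7" using that by simp
      then show ?thesis using sorted[of 0 7] q[of 7] q[of 0] by (auto simp: p_def)
    qed
  qed
qed

text \<open>For a point \<open>z\<close> in the open sector both \<open>sin (t j - t i)\<close> and \<open>sin (t (Suc i) - t j)\<close> are
  positive, which is impossible for an argument \<open>t j\<close> outside of the interval from \<open>t i\<close> to \<open>t (Suc i)\<close>. A point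
  on the boundary of the sector has the same direction as \<open>p i\<close> or \<open>p (Suc i)\<close>, so it is this point.\<close>

lemma consecutive_sector_empty:
  assumes X: "hard_core X" "x \<in> X"
    and p: "p ` {..<8} = nbrs X x" "p 8 = p 0" "t 8 = t 0 + 2 * pi"
    and polar: "\<And>i. i \<le> 8 \<Longrightarrow> p i - x = of_real (cmod (p i - x)) * cis (t i)"
    and mono: "\<And>i j. i < j \<Longrightarrow> j \<le> 8 \<Longrightarrow> t i < t j"
    and i: "i < 8" "t (Suc i) - t i < pi"
  shows "empty_sector X x (p i) (p (Suc i))"
  unfolding empty_sector_def
proof (intro ballI allI impI)
  fix z l m
  assume z: "z \<in> nbrs X x" and lm: "0 \<le> l" "0 \<le> (m::real)"
    and eq: "z - x = of_real l * (p i - x) + of_real m * (p (Suc i) - x)"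
  have N: "p j \<in> nbrs X x" if "j \<le> 8" for j
    using that p by (cases "j = 8") auto
  obtain j where j: "j < 8" "z = p j" using z p(1) by auto
  have zx: "z \<noteq> x" using z by (auto simp: nbrs_def)
  have same: "y = w" if "y \<in> nbrs X x" "w \<in> nbrs X x" "y - x = of_real k * (w - x)" "0 \<le> k" for y w k
  proof (rule ccontr)
    assume "y \<noteq> w"
    have "y \<noteq> x" using that by (auto simp: nbrs_def)
    then have "0 < k" using that by (cases "k = 0") auto
    have "y - x = of_real (cmod (y - x)) * cis (Arg2pi (w - x))"
      using Arg2pi_cis[of "y - x"] that(3) Arg2pi_times_of_real[OF \<open>0 < k\<close>, of "w - x"] by metis
    from nbrs_separated[OF X that(1,2) \<open>y \<noteq> w\<close> this Arg2pi_cis] show False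
      using sep_angle_pos by simp
  qed
  show "z = p i \<or> z = p (Suc i)"
  proof (cases "l = 0 \<or> m = 0")
    case True
    then show ?thesis using same[OF z N[of i], of l] same[OF z N[of "Suc i"], of m] eq lm i by auto
  next
    case False
    then have l: "0 < l" and m: "0 < m" using lm by auto
    define r where "r k = cmod (p k - x)" for k
    have r: "0 < r k" if "k \<le> 8" for k using N[OF that] by (auto simp: r_def nbrs_def)
    have eq': "of_real (r j) * cis (t j) = of_real (l * r i) * cis (t i) + of_real (m * r (Suc i)) * cis (t (Suc i))"
    proof -
      have "p k - x = of_real (r k) * cis (t k)" if "k \<le> 8" for k
        unfolding r_def using polar[OF that] .
      from this[of j] this[of i] this[of "Suc i"] show ?thesis using eq j i
        by (metis (no_types, lifting) Suc_leI less_imp_le mult.assoc of_real_mult)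
    qed
    have c: "r j * cos (t j) = l * r i * cos (t i) + m * r (Suc i) * cos (t (Suc i))"
      using arg_cong[OF eq', of Re] by simp
    have s: "r j * sin (t j) = l * r i * sin (t i) + m * r (Suc i) * sin (t (Suc i))"
      using arg_cong[OF eq', of Im] by simp
    have gap: "0 < sin (t (Suc i) - t i)" using i mono[of i "Suc i"] by (intro sin_gt_zero) auto
    have "r j * sin (t j - t i) = (r j * sin (t j)) * cos (t i) - (r j * cos (t j)) * sin (t i)"
      by (simp add: sin_diff algebra_simps)
    also have "\<dots> = m * r (Suc i) * sin (t (Suc i) - t i)"
      unfolding s c by (simp add: sin_diff algebra_simps)
    also have "\<dots> > 0" using m r[of "Suc i"] i gap by simp
    finally have s1: "0 < sin (t j - t i)" using r[of j] j by (simp add: zero_less_mult_iff)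
    have "r j * sin (t (Suc i) - t j) = sin (t (Suc i)) * (r j * cos (t j)) - cos (t (Suc i)) * (r j * sin (t j))"
      by (simp add: sin_diff algebra_simps)
    also have "\<dots> = l * r i * sin (t (Suc i) - t i)"
      unfolding s c by (simp add: sin_diff algebra_simps)
    also have "\<dots> > 0" using l r[of i] i gap by simp
    finally have s2: "0 < sin (t (Suc i) - t j)" using r[of j] j by (simp add: zero_less_mult_iff)
    have le: "t a \<le> t b" if "a \<le> b" "b \<le> 8" for a b
      using mono[of a b] that by (cases "a = b") auto
    have span: "t (Suc i) - t j \<le> 2 * pi" "t j - t i < 2 * pi"
      using le[of 0 j] le[of "Suc i" 8] le[of 0 i] mono[of j 8] p(3) i j by auto
    have neg: "sin u \<le> 0" if "pi \<le> u" "u \<le> 2 * pi" for u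
      using that sin_ge_zero[of "u - pi"] by (simp add: sin_diff)
    have False
    proof (cases "j \<le> i")
      case True
      have "pi < t i - t j"
      proof (rule ccontr)
        assume "\<not> ?thesis"
        then have "0 \<le> sin (t i - t j)" using le[of j i] True i by (intro sin_ge_zero) auto
        then show False using s1 sin_minus[of "t i - t j"] by simp
      qed
      then show False using neg[of "t (Suc i) - t j"] s2 span mono[of i "Suc i"] i by auto
    next
      case False
      then have "Suc i \<le> j" by simp
      have "pi < t j - t (Suc i)"
      proof (rule ccontr)
        assume "\<not> ?thesis"
        then have "0 \<le> sin (t j - t (Suc i))" using le[of "Suc i" j] \<open>Suc i \<le> j\<close> j by (intro sin_ge_zero) auto
        then show False using s2 sin_minus[of "t j - t (Suc i)"] by simp
      qed
      then show False using neg[of "t j - t i"] s1 span mono[of i "Suc i"] i by auto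
    qed
    then show ?thesis ..
  qed
qed

section \<open>The angle balance around a vertex\<close>

text \<open>For \<open>p = \<pi>\<close>, the excess \<open>M\<close> or \<open>N\<close> of a sector (0 for a square sector, \<open>\<pi>/4\<close> otherwise) is shared equally by
  its two outer vertices. The angles \<open>C\<close> and \<open>B\<close> of the two sectors that meet in a vertex exceed \<open>\<pi>/2\<close> at most by the
  shares of this vertex.\<close>

lemma half_weights:
  fixes B C M N p :: real
  assumes "0 < p" "B + C < 5 * p / 8" "M = p / 4 \<or> M = 0 \<and> C = p / 4" "N = p / 4 \<or> N = 0 \<and> B = p / 4"
  shows "2 * (C + B) \<le> p + (M + N)" "0 < M + N \<Longrightarrow> 2 * (C + B) < p + (M + N)"
  using assms by (elim disjE conjE; simp add: field_simps)+

text \<open>The three angles attached to a sector have the sum \<open>3 \<pi> / 4\<close> for a square sector and \<open>\<pi>\<close>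
  otherwise; \<open>M\<close> is the excess over \<open>3 \<pi> / 4\<close>. Summing over all sectors, the angles
  at the outer vertices have the total \<open>4 \<pi> + \<Sum>M\<close>. By \<open>half_weights\<close>, summing over the outer vertices instead gives at most this
  value, and less as soon as some excess is positive.\<close>

lemma all_sectors_square:
  assumes X: "hard_core X" "x \<in> X"
    and full: "\<And>y. y \<in> nbrs X x \<Longrightarrow> card (nbrs X y) = 8"
    and p: "p ` {..<8} = nbrs X x" "p 8 = p 0" "t 8 = t 0 + 2 * pi"
    and polar: "\<And>i. i \<le> 8 \<Longrightarrow> p i - x = of_real (cmod (p i - x)) * cis (t i)"
    and step: "\<And>i. i < 8 \<Longrightarrow> t i < t (Suc i)"
    and distinct: "\<And>i. i < 8 \<Longrightarrow> p i \<noteq> p (Suc i)"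
    and i: "i < 8"
  shows "square_sector x (p i) (p (Suc i))"
proof -
  have mono: "t i < t j" if "i < j" "j \<le> 8" for i j
    using that
  proof (induction j)
    case (Suc j)
    then show ?case using step[of j] by (cases "i = j") force+
  qed simp
  have N: "p j \<in> nbrs X x" if "j \<le> 8" for j
    using that p by (cases "j = 8") auto
  define th where "th i = t (Suc i) - t i" for i
  have th: "sep_angle < th i" if "i < 8" for i
    using nbrs_separated[OF X N[of "Suc i"] N[of i] _ polar[of "Suc i"] polar[of i]] that step[of i] distinct[of i]
    unfolding th_def by auto
  have total: "th 0 + th 1 + th 2 + th 3 + th 4 + th 5 + th 6 + th 7 = 2 * pi"
    using p(3) by (simp add: th_def eval_nat_numeral)
  have bounded: "th i < pi" if "i < 8" for i
  proof -
    have "i \<in> {0,1,2,3,4,5,6,7}" using that by auto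
    then show ?thesis
      using total th[of 0] th[of 1] th[of 2] th[of 3] th[of 4] th[of 5] th[of 6] th[of 7] pi_gt_zero
      unfolding sep_angle_def by auto
  qed
  have ccw: "ccw x (p i) (p (Suc i)) = th i" if "i < 8" for i
  proof -
    have nz: "p i \<noteq> x" "p (Suc i) \<noteq> x" using N[of i] N[of "Suc i"] that by (auto simp: nbrs_def)
    have "(p (Suc i) - x) / (p i - x) =
        (of_real (cmod (p (Suc i) - x)) * cis (t (Suc i))) / (of_real (cmod (p i - x)) * cis (t i))"
      using polar[of i] polar[of "Suc i"] that by (metis Suc_leI less_imp_le)
    also have "\<dots> = of_real (cmod (p (Suc i) - x) / cmod (p i - x)) * cis (th i)"
      unfolding th_def by (simp flip: cis_divide)
    finally show ?thesis
      unfolding ccw_def using nz bounded[OF that] th[OF that] sep_angle_pos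
      by (intro Arg2pi_unique[of "cmod (p (Suc i) - x) / cmod (p i - x)"]) (auto simp: cis_conv_exp)
  qed
  have "\<exists>B C. (\<forall>z \<in> nbrs X (p i) - {x}. ccw (p i) x z \<le> 2 * pi - B) \<and>
      (\<forall>z \<in> nbrs X (p (Suc i)) - {x}. C \<le> ccw (p (Suc i)) x z) \<and>
      (th i + B + C = pi \<or>
        th i = pi / 4 \<and> B = pi / 4 \<and> C = pi / 4 \<and> square_sector x (p i) (p (Suc i)))"
    if "i < 8" for i
  proof -
    have "empty_sector X x (p i) (p (Suc i))"
      using bounded[OF that] that unfolding th_def
      by (intro consecutive_sector_empty[OF X p polar mono]) auto
    moreover have "0 < ccw x (p i) (p (Suc i))" "ccw x (p i) (p (Suc i)) < pi"
      using bounded[OF that] th[OF that] sep_angle_pos by (simp_all add: ccw[OF that])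
    moreover have "p i \<in> nbrs X x" "p (Suc i) \<in> nbrs X x" using N that by auto
    ultimately obtain B C where "\<And>z. z \<in> nbrs X (p i) - {x} \<Longrightarrow> ccw (p i) x z \<le> 2 * pi - B"
      "\<And>z. z \<in> nbrs X (p (Suc i)) - {x} \<Longrightarrow> C \<le> ccw (p (Suc i)) x z"
      "ccw x (p i) (p (Suc i)) + B + C = pi \<or> ccw x (p i) (p (Suc i)) = pi / 4 \<and>
         B = pi / 4 \<and> C = pi / 4 \<and> square_sector x (p i) (p (Suc i))"
      using sector_angles[OF X, of "p i" "p (Suc i)"] by metis
    then show ?thesis unfolding ccw[OF that] by blast
  qed
  then obtain B C where
    B: "\<And>i z. i < 8 \<Longrightarrow> z \<in> nbrs X (p i) - {x} \<Longrightarrow> ccw (p i) x z \<le> 2 * pi - B i" and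
    C: "\<And>i z. i < 8 \<Longrightarrow> z \<in> nbrs X (p (Suc i)) - {x} \<Longrightarrow> C i \<le> ccw (p (Suc i)) x z" and
    BC: "\<And>i. i < 8 \<Longrightarrow> th i + B i + C i = pi \<or>
        th i = pi / 4 \<and> B i = pi / 4 \<and> C i = pi / 4 \<and> square_sector x (p i) (p (Suc i))"
    by metis
  define M where "M i = th i + B i + C i - 3 * pi / 4" for i
  have M: "M i = pi / 4 \<or> M i = 0 \<and> B i = pi / 4 \<and> C i = pi / 4 \<and> square_sector x (p i) (p (Suc i))"
    if "i < 8" for i
    using BC[OF that] unfolding M_def by auto
  have vertex: "2 * (C i + B j) \<le> pi + (M i + M j) \<and> (0 < M i + M j \<longrightarrow> 2 * (C i + B j) < pi + (M i + M j))"
    if ij: "i < 8" "j < 8" "p (Suc i) = p j" for i j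
  proof -
    have "p j \<in> X" "x \<in> nbrs X (p j)" using N[of j] ij(2) nbrsD(1)[OF X] nbrs_sym[OF X(2)] by auto
    then have sum: "B j + C i < 5 * pi / 8"
      using B[OF ij(2)] C[OF ij(1)] full[OF N[of j]] ij
      by (intro angles_at_full_vertex[OF X(1)]) auto
    show ?thesis
      using half_weights[OF pi_gt_zero sum, of "M i" "M j"] M[OF ij(1)] M[OF ij(2)] by blast
  qed
  have "C 0 + B 1 + (C 1 + B 2) + (C 2 + B 3) + (C 3 + B 4) + (C 4 + B 5) + (C 5 + B 6) + (C 6 + B 7) + (C 7 + B 0)
    = 4 * pi + (M 0 + M 1 + M 2 + M 3 + M 4 + M 5 + M 6 + M 7)"
    using total unfolding M_def by simp
  moreover note v = vertex[of 0 1] vertex[of 1 2] vertex[of 2 3] vertex[of 3 4] vertex[of 4 5]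
    vertex[of 5 6] vertex[of 6 7] vertex[of 7 0]
  ultimately have eq: "M 0 + M 1 \<le> 0 \<and> M 1 + M 2 \<le> 0 \<and> M 2 + M 3 \<le> 0 \<and> M 3 + M 4 \<le> 0 \<and>
     M 4 + M 5 \<le> 0 \<and> M 5 + M 6 \<le> 0 \<and> M 6 + M 7 \<le> 0"
    using p(2) by (simp add: eval_nat_numeral)
  have nn: "0 \<le> M i" if "i < 8" for i
  proof -
    have "0 \<le> pi / 4" by simp
    then show ?thesis using M[OF that] by (metis order_refl)
  qed
  have "i \<in> {0,1,2,3,4,5,6,7}" using i by auto
  then have "M i = 0"
    using eq nn[of 0] nn[of 1] nn[of 2] nn[of 3] nn[of 4] nn[of 5] nn[of 6] nn[of 7] by auto
  then show ?thesis using M[OF i] pi_gt_zero by auto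
qed

text \<open>The eight neighbors of 0 in the lattice of Gaussian integers.\<close>

definition king_moves :: "complex set" where
  "king_moves = {1, 1 + \<i>, \<i>, -1 + \<i>, -1, -1 - \<i>, - \<i>, 1 - \<i>}"

text \<open>Square sectors alternate between the two orientations, because a neighbor cannot be at
  distance 1 and \<open>sqrt 2\<close> at once; two consecutive ones therefore turn the vector from \<open>x\<close>
  to a neighbor at distance 1 by a right angle. The two cases at the end only concern
  whether the enumeration starts with a short or with a long edge.\<close>

lemma full_neighborhood_king_moves:
  assumes X: "hard_core X" "x \<in> X" and card: "card (nbrs X x) = 8"
    and full: "\<And>y. y \<in> nbrs X x \<Longrightarrow> card (nbrs X y) = 8"
  obtains v where "cmod v = 1" "nbrs X x = (\<lambda>w. x + v * w) ` king_moves"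
proof -
  obtain p t where p: "p ` {..<8} = nbrs X x" "p 8 = p 0" "t 8 = t 0 + 2 * pi"
    "\<And>i. i \<le> 8 \<Longrightarrow> p i - x = of_real (cmod (p i - x)) * cis (t i)"
    "\<And>i. i < 8 \<Longrightarrow> t i < t (Suc i)" "\<And>i. i < 8 \<Longrightarrow> p i \<noteq> p (Suc i)"
    by (rule full_vertex_enumeration[OF X card]) blast
  have sq: "square_sector x (p i) (p (Suc i))" if "i < 8" for i
    using all_sectors_square[OF X full p that] .
  define d where "d i = p i - x" for i
  have d: "cmod (d i) = 1 \<and> d (Suc i) = (1 + \<i>) * d i \<or> cmod (d (Suc i)) = 1 \<and> d i = (1 - \<i>) * d (Suc i)"
    if "i < 8" for i
    using sq[OF that] by (simp add: d_def square_sector_def)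
  have long: "cmod (1 + \<i>) \<noteq> 1" "cmod (1 - \<i>) \<noteq> 1" by (auto simp: cmod_def)
  have turn1: "d (Suc i) = (1 + \<i>) * d i" if "i < 8" "cmod (d i) = 1" for i
    using d[OF that(1)] that(2) long by (auto simp: norm_mult)
  have turn2: "d (Suc (Suc i)) = \<i> * d i" if "Suc i < 8" "cmod (d i) = 1" for i
  proof -
    have 1: "d (Suc i) = (1 + \<i>) * d i" using turn1 that by simp
    then have "cmod (d (Suc i)) \<noteq> 1" using that long by (simp add: norm_mult)
    then have "d (Suc i) = (1 - \<i>) * d (Suc (Suc i))" using d[OF that(1)] by auto
    then have "(1 + \<i>) * ((1 - \<i>) * d (Suc (Suc i))) = (1 + \<i>) * ((1 + \<i>) * d i)" using 1 by simp
    then have "2 * d (Suc (Suc i)) = 2 * (\<i> * d i)" by (simp add: algebra_simps)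
    then show ?thesis by simp
  qed
  have cycle: "d (k + 1) = (1 + \<i>) * d k \<and> d (k + 2) = \<i> * d k \<and> d (k + 3) = (-1 + \<i>) * d k \<and>
      d (k + 4) = - d k \<and> d (k + 5) = (-1 - \<i>) * d k \<and> d (k + 6) = - \<i> * d k"
    if k: "k \<le> 1" "cmod (d k) = 1" for k
  proof -
    have 2: "d (k + 2) = \<i> * d k" using turn2[of k] k by simp
    then have n2: "cmod (d (k + 2)) = 1" using k by (simp add: norm_mult)
    have 4: "d (k + 4) = \<i> * d (k + 2)" using turn2[of "k + 2"] k n2 by (simp add: eval_nat_numeral)
    then have n4: "cmod (d (k + 4)) = 1" using n2 by (simp add: norm_mult)
    have 6: "d (k + 6) = \<i> * d (k + 4)" using turn2[of "k + 4"] k n4 by (simp add: eval_nat_numeral)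
    have 3: "d (k + 3) = (1 + \<i>) * d (k + 2)" using turn1[of "k + 2"] k n2 by (simp add: eval_nat_numeral)
    have 5: "d (k + 5) = (1 + \<i>) * d (k + 4)" using turn1[of "k + 4"] k n4 by (simp add: eval_nat_numeral)
    have 1: "d (k + 1) = (1 + \<i>) * d k" using turn1[of k] k by simp
    show ?thesis using 1 2 3 4 5 6 by (simp add: algebra_simps)
  qed
  have Nd: "nbrs X x = (\<lambda>i. x + d i) ` {0,1,2,3,4,5,6,7}"
    by (subst p(1)[symmetric]) (auto simp: d_def lessThan_nat_numeral lessThan_Suc)
  consider "cmod (d 0) = 1" | "cmod (d 1) = 1" "d 0 = (1 - \<i>) * d 1" using d[of 0] by auto
  then show thesis
  proof cases
    case 1
    have d6: "cmod (d 6) = 1" using cycle[of 0] 1 by (simp add: norm_mult)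
    have "d 7 = (1 - \<i>) * d 0"
      using turn1[of 6] d6 cycle[of 0] 1 by (simp add: algebra_simps)
    then show thesis
      using 1 cycle[of 0] by (intro that[of "d 0"]) (auto simp: Nd king_moves_def numeral_2_eq_2 numeral_3_eq_3 mult.commute)
  next
    case 2
    have "d 2 = (1 + \<i>) * d 1" "d 3 = \<i> * d 1" "d 4 = (-1 + \<i>) * d 1" "d 5 = - d 1"
      "d 6 = (-1 - \<i>) * d 1" "d 7 = - \<i> * d 1"
      using cycle[of 1] 2(1) by (simp_all add: eval_nat_numeral)
    then show thesis
      using 2 by (intro that[of "d 1"]) (auto simp: Nd king_moves_def mult.commute)
  qed
qed

section \<open>From the plane to the complex numbers\<close>

definition to_complex :: "real ^ 2 \<Rightarrow> complex" where
  "to_complex x = Complex (x $ 1) (x $ 2)"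

lemma norm_vec2: "norm (x :: real ^ 2) = sqrt ((x $ 1)\<^sup>2 + (x $ 2)\<^sup>2)"
  by (simp add: norm_vec_def L2_set_def sum_2)

lemma dist_to_complex [simp]: "dist (to_complex x) (to_complex y) = dist x y"
  by (simp add: dist_norm norm_vec2 to_complex_def cmod_def)

lemma inj_to_complex: "inj to_complex"
  by (metis dist_to_complex dist_eq_0_iff injI)

lemma hard_core_to_complex: "X \<in> hard_core_configs \<Longrightarrow> hard_core (to_complex ` X)"
  by (auto simp: hard_core_configs_def hard_core_def)

section \<open>The energy as a sum of degrees\<close>

lemma nearest_neighbors_altdef:
  assumes "X \<in> hard_core_configs" "x \<in> X"
  shows "nearest_neighbors X x = {y \<in> X. y \<noteq> x \<and> dist x y \<le> sqrt 2}"
  using assms unfolding nearest_neighbors_def edges0_def hard_core_configs_def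
  by (fastforce simp: doubleton_eq_iff dist_commute)

lemma nbrs_to_complex:
  assumes "X \<in> hard_core_configs" "x \<in> X"
  shows "nbrs (to_complex ` X) (to_complex x) = to_complex ` nearest_neighbors X x"
  using inj_to_complex by (auto simp: nearest_neighbors_altdef[OF assms] nbrs_def dest: injD)

lemma card_nbrs_to_complex:
  assumes "X \<in> hard_core_configs" "x \<in> X"
  shows "card (nbrs (to_complex ` X) (to_complex x)) = card (nearest_neighbors X x)"
  unfolding nbrs_to_complex[OF assms]
  by (rule card_image) (meson inj_on_subset inj_to_complex subset_UNIV)

lemma card_nearest_neighbors_le_8:
  assumes "X \<in> hard_core_configs" "x \<in> X"
  shows "card (nearest_neighbors X x) \<le> 8"
  using nbrs_finite_card_le_8(2)[OF hard_core_to_complex[OF assms(1)], of "to_complex x"]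
    card_nbrs_to_complex[OF assms] assms(2) by simp

lemma energy_hard_core:
  assumes "X \<in> hard_core_configs" "finite X"
  shows "energy sticky_potential X = ereal (- (1/2) * (\<Sum>x\<in>X. real (card (nearest_neighbors X x))))"
proof -
  have "(\<Sum>y\<in>X - {x}. sticky_potential (dist x y)) = ereal (- real (card (nearest_neighbors X x)))"
    if x: "x \<in> X" for x
  proof -
    have "(\<Sum>y\<in>X - {x}. sticky_potential (dist x y)) =
        (\<Sum>y\<in>X - {x}. ereal (if dist x y \<le> sqrt 2 then -1 else 0))"
    proof (intro sum.cong refl)
      fix y assume "y \<in> X - {x}"
      then have "1 \<le> dist x y" using assms(1) x by (auto simp: hard_core_configs_def)
      then show "sticky_potential (dist x y) = ereal (if dist x y \<le> sqrt 2 then -1 else 0)"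
        by (simp add: sticky_potential_def one_ereal_def zero_ereal_def)
    qed
    also have "\<dots> = ereal (\<Sum>y\<in>X - {x}. if dist x y \<le> sqrt 2 then -1 else 0)" by simp
    also have "(\<Sum>y\<in>X - {x}. if dist x y \<le> sqrt 2 then -1 else 0) =
        - real (card {y \<in> X - {x}. dist x y \<le> sqrt 2})"
      using assms(2) by (simp add: sum.If_cases Int_def)
    also have "{y \<in> X - {x}. dist x y \<le> sqrt 2} = nearest_neighbors X x"
      using nearest_neighbors_altdef[OF assms(1) x] by auto
    finally show ?thesis .
  qed
  then show ?thesis by (simp add: energy_def sum_negf)
qed

lemma energy_overlapping:
  assumes "X \<notin> hard_core_configs" "finite X"
  shows "energy sticky_potential X = \<infinity>"
proof -
  obtain x y where xy: "x \<in> X" "y \<in> X - {x}" "dist x y < 1"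
    using assms(1) by (fastforce simp: hard_core_configs_def not_le)
  then have "(\<Sum>y\<in>X - {x}. sticky_potential (dist x y)) = \<infinity>"
    using assms(2) by (auto simp: sum_Pinfty sticky_potential_def)
  then have "(\<Sum>x\<in>X. \<Sum>y\<in>X - {x}. sticky_potential (dist x y)) = \<infinity>"
    using xy(1) assms(2) sum_Pinfty by blast
  then show ?thesis by (simp add: energy_def)
qed

lemma energy_values:
  assumes "finite X"
  shows "energy sticky_potential X \<in> insert \<infinity> ((\<lambda>k. ereal (- real k / 2)) ` {..8 * card X})"
proof (cases "X \<in> hard_core_configs")
  case True
  have "(\<Sum>x\<in>X. card (nearest_neighbors X x)) \<le> 8 * card X"
    using sum_bounded_above[of X "\<lambda>x. card (nearest_neighbors X x)" 8]
      card_nearest_neighbors_le_8[OF True] by (simp add: mult.commute)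
  moreover have "energy sticky_potential X = ereal (- real (\<Sum>x\<in>X. card (nearest_neighbors X x)) / 2)"
    by (simp add: energy_hard_core[OF True assms])
  ultimately show ?thesis by blast
qed (use assms energy_overlapping in simp)

lemma energy_lower_bound:
  assumes "finite X"
  shows "ereal (- 4 * real (card X)) \<le> energy sticky_potential X"
  using energy_values[OF assms] by auto

text \<open>By \<open>energy_values\<close> only finitely many energies occur for a given number of points, so the
  least one exists.\<close>

lemma min_energy_attained:
  assumes "infinite A"
  obtains X where "X \<subseteq> A" "finite X" "card X = N"
    "min_energy_in A sticky_potential N = energy sticky_potential X"
proof -
  let ?P = "\<lambda>e. \<exists>X\<subseteq>A. finite X \<and> card X = N \<and> e = energy sticky_potential X"
  have "{e. ?P e} \<subseteq> insert \<infinity> ((\<lambda>k. ereal (- real k / 2)) ` {..8 * N})"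
    using energy_values by blast
  then have fin: "finite {e. ?P e}" by (rule finite_subset) simp
  have ex: "\<exists>e. ?P e" using infinite_arbitrarily_large[OF assms] by blast
  then have "min_energy_in A sticky_potential N \<in> {e. ?P e}"
    unfolding min_energy_in_def Least_Min[OF fin ex] using fin by (intro Min_in) auto
  then show thesis using that by blast
qed

lemma min_energy_le:
  assumes "X \<subseteq> A" "finite X" "card X = N"
  shows "min_energy_in A sticky_potential N \<le> energy sticky_potential X"
proof -
  let ?P = "\<lambda>e. \<exists>X\<subseteq>A. finite X \<and> card X = N \<and> e = energy sticky_potential X"
  have "{e. ?P e} \<subseteq> insert \<infinity> ((\<lambda>k. ereal (- real k / 2)) ` {..8 * N})"
    using energy_values by blast
  then have fin: "finite {e. ?P e}" by (rule finite_subset) simp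
  have X: "?P (energy sticky_potential X)" using assms by blast
  then have "\<exists>e. ?P e" by blast
  from Least_Min[OF fin this] show ?thesis
    unfolding min_energy_in_def using Min_le[OF fin] X by simp
qed

section \<open>Lattice points in convex sets\<close>

abbreviation pt :: "real \<Rightarrow> real \<Rightarrow> real ^ 2" where "pt a b \<equiv> vector [a, b]"

lemma vec2_eq_iff: "(x :: real ^ 2) = y \<longleftrightarrow> x $ 1 = y $ 1 \<and> x $ 2 = y $ 2"
  by (simp add: vec_eq_iff forall_2)

lemma square_lattice_altdef: "x \<in> square_lattice \<longleftrightarrow> x $ 1 \<in> \<int> \<and> x $ 2 \<in> \<int>"
  by (simp add: square_lattice_def forall_2)

lemma square_lattice_add: "x \<in> square_lattice \<Longrightarrow> y \<in> square_lattice \<Longrightarrow> x + y \<in> square_lattice"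
  by (simp add: square_lattice_altdef)

lemma square_lattice_hard_core:
  assumes "L \<subseteq> square_lattice"
  shows "L \<in> hard_core_configs"
  unfolding hard_core_configs_def
proof (intro CollectI ballI impI)
  fix x y assume xy: "x \<in> L" "y \<in> L" "x \<noteq> y"
  then have "x \<in> square_lattice" "y \<in> square_lattice" using assms by auto
  then have int: "(x - y) $ i \<in> \<int>" for i by (simp add: square_lattice_def)
  obtain i where "(x - y) $ i \<noteq> 0" using xy by (auto simp: vec_eq_iff)
  then have "1 \<le> \<bar>(x - y) $ i\<bar>" using int Ints_nonzero_abs_ge1 by blast
  also have "\<dots> \<le> norm (x - y)" by (rule component_le_norm_cart)
  finally show "1 \<le> dist x y" by (simp add: dist_norm)
qed

text \<open>The differences between neighbors in the square lattice. All coordinates are 0, 1 or -1, so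
  each difference is a primitive lattice vector, and the lattice points on a line in its direction
  are equally spaced by it.\<close>

definition lattice_steps :: "(real ^ 2) set" where
  "lattice_steps = {pt 1 0, pt 1 1, pt 0 1, pt (-1) 1, pt (-1) 0, pt (-1) (-1), pt 0 (-1), pt 1 (-1)}"

lemma finite_lattice_steps: "finite lattice_steps" and card_lattice_steps: "card lattice_steps = 8"
  by (auto simp: lattice_steps_def vec2_eq_iff)

lemma lattice_steps_props:
  assumes "d \<in> lattice_steps"
  shows "d \<in> square_lattice" "d $ 1 = 0 \<or> \<bar>d $ 1\<bar> = 1" "d $ 2 = 0 \<or> \<bar>d $ 2\<bar> = 1" "d \<noteq> 0" "norm d \<le> sqrt 2"
  using assms by (auto simp: lattice_steps_def square_lattice_altdef vec2_eq_iff norm_vec2)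

lemma lattice_steps_parallel:
  assumes d: "d \<in> lattice_steps" and w: "w \<in> square_lattice" and par: "d $ 1 * w $ 2 = d $ 2 * w $ 1"
  obtains k :: int where "w = of_int k *\<^sub>R d"
proof -
  define k where "k = (if d $ 1 \<noteq> 0 then d $ 1 * w $ 1 else d $ 2 * w $ 2)"
  have "d $ 1 \<in> \<int>" "d $ 2 \<in> \<int>" "w $ 1 \<in> \<int>" "w $ 2 \<in> \<int>"
    using w lattice_steps_props(1)[OF d] by (auto simp: square_lattice_altdef)
  then have "k \<in> \<int>" by (simp add: k_def)
  moreover have "w = k *\<^sub>R d"
  proof (cases "d $ 1 = 0")
    case True
    then have "d $ 2 \<noteq> 0" "d $ 2 * d $ 2 = 1"
      using lattice_steps_props(3,4)[OF d] by (auto simp: vec2_eq_iff abs_if split: if_splits)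
    then show ?thesis using True par by (simp add: k_def vec2_eq_iff mult_ac)
  next
    case False
    then have "d $ 1 * d $ 1 = 1"
      using lattice_steps_props(2)[OF d] by (auto simp: abs_if split: if_splits)
    then have "w $ 1 = d $ 1 * w $ 1 * d $ 1" "w $ 2 = d $ 1 * w $ 1 * d $ 2" using par by algebra+
    then show ?thesis using False by (simp add: k_def vec2_eq_iff)
  qed
  ultimately show thesis using that by (metis Ints_cases)
qed

lemma Ints_eq_floor: "a \<in> \<int> \<Longrightarrow> of_int \<lfloor>a\<rfloor> = (a :: real)"
  by (auto elim: Ints_cases)

text \<open>By convexity, a lattice line in direction \<open>d\<close> leaves \<open>K\<close> only once, so each exit point is determined by its
  line. The lines are labelled by the integer \<open>d $ 1 * x $ 2 - d $ 2 * x $ 1\<close>, which is at most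
  \<open>2 * r\<close> in absolute value.\<close>

lemma exit_points_card:
  fixes K :: "(real ^ 2) set"
  assumes "convex K" and r: "\<And>x. x \<in> square_lattice \<inter> K \<Longrightarrow> \<bar>x $ 1\<bar> \<le> r \<and> \<bar>x $ 2\<bar> \<le> r" and "0 \<le> r"
    and d: "d \<in> lattice_steps"
  shows "real (card {x \<in> square_lattice \<inter> K. x + d \<notin> K}) \<le> 4 * r + 1"
proof -
  let ?S = "{x \<in> square_lattice \<inter> K. x + d \<notin> K}"
  let ?line = "\<lambda>x :: real ^ 2. d $ 1 * x $ 2 - d $ 2 * x $ 1"
  have step: False if "x \<in> K" "x + d \<notin> K" "y \<in> K" "y - x = of_int k *\<^sub>R d" "1 \<le> k" for x y and k :: int
  proof -
    have "x + d = (1 - 1 / of_int k) *\<^sub>R x + (1 / of_int k) *\<^sub>R y"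
    proof -
      have "y = x + of_int k *\<^sub>R d" using that(4) by (simp add: algebra_simps)
      then show ?thesis using that(5) by (simp add: algebra_simps)
    qed
    also have "\<dots> \<in> K" using that by (intro convexD[OF \<open>convex K\<close>]) auto
    finally show False using that by simp
  qed
  have ints: "?line x \<in> \<int>" if "x \<in> square_lattice" for x
    using that lattice_steps_props(1)[OF d] by (auto simp: square_lattice_altdef)
  have inj: "inj_on (\<lambda>x. \<lfloor>?line x\<rfloor>) ?S"
  proof (rule inj_onI)
    fix x y assume x: "x \<in> ?S" and y: "y \<in> ?S" and eq: "\<lfloor>?line x\<rfloor> = \<lfloor>?line y\<rfloor>"
    have "x \<in> square_lattice" "y \<in> square_lattice" using x y by auto
    from ints[OF this(1), THEN Ints_eq_floor] ints[OF this(2), THEN Ints_eq_floor] eq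
    have "?line x = ?line y" by metis
    moreover have "y - x \<in> square_lattice" using x y by (auto simp: square_lattice_def)
    ultimately obtain k :: int where k: "y - x = of_int k *\<^sub>R d"
      using lattice_steps_parallel[OF d, of "y - x"] by (auto simp: algebra_simps)
    have "x - y = of_int (- k) *\<^sub>R d" using k by (simp add: algebra_simps)
    then have "\<not> 1 \<le> k" "\<not> 1 \<le> - k" using step[of x y k] step[of y x "-k"] k x y by auto
    then have "k = 0" by linarith
    with k show "x = y" by simp
  qed
  have "\<lfloor>?line x\<rfloor> \<in> {\<lceil>- (2 * r)\<rceil>..\<lfloor>2 * r\<rfloor>}" if x: "x \<in> ?S" for x
  proof -
    have "\<bar>d $ 1 * x $ 2\<bar> \<le> 1 * r" "\<bar>d $ 2 * x $ 1\<bar> \<le> 1 * r"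
      unfolding abs_mult using lattice_steps_props(2,3)[OF d] r[of x] x \<open>0 \<le> r\<close>
      by (auto intro!: mult_mono)
    then have bounds: "- (2 * r) \<le> ?line x" "?line x \<le> 2 * r" by linarith+
    have "x \<in> square_lattice" using x by simp
    from Ints_eq_floor[OF ints[OF this]] bounds(1) have "- (2 * r) \<le> of_int \<lfloor>?line x\<rfloor>" by metis
    then have "\<lceil>- (2 * r)\<rceil> \<le> \<lfloor>?line x\<rfloor>" by (simp only: ceiling_le_iff)
    with floor_mono[OF bounds(2)] show ?thesis by (simp only: atLeastAtMost_iff simp_thms)
  qed
  then have "(\<lambda>x. \<lfloor>?line x\<rfloor>) ` ?S \<subseteq> {\<lceil>- (2 * r)\<rceil>..\<lfloor>2 * r\<rfloor>}" by blast
  then have "card ?S \<le> card {\<lceil>- (2 * r)\<rceil>..\<lfloor>2 * r\<rfloor>}"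
    unfolding card_image[OF inj, symmetric] by (rule card_mono[OF finite_atLeastAtMost_int])
  also have "\<dots> = nat (2 * \<lfloor>2 * r\<rfloor> + 1)" by (simp add: ceiling_minus)
  finally have "real (card ?S) \<le> real_of_int (2 * \<lfloor>2 * r\<rfloor> + 1)"
    using \<open>0 \<le> r\<close> by (simp add: le_nat_iff)
  also have "\<dots> \<le> 4 * r + 1" using of_int_floor_le[of "2 * r"] by linarith
  finally show ?thesis .
qed

text \<open>Each of the eight directions contributes at most \<open>4 * r + 1\<close> points without a neighbor in this
  direction; all other points have degree 8, which is worth the energy \<open>-4\<close>.\<close>

lemma energy_lattice_convex:
  fixes K :: "(real ^ 2) set"
  defines "L \<equiv> square_lattice \<inter> K"
  assumes "convex K" "finite L" and r: "\<And>x. x \<in> L \<Longrightarrow> \<bar>x $ 1\<bar> \<le> r \<and> \<bar>x $ 2\<bar> \<le> r" and "0 \<le> r"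
  shows "energy sticky_potential L \<le> ereal (- 4 * real (card L) + 32 * (4 * r + 1))"
proof -
  have hc: "L \<in> hard_core_configs" by (rule square_lattice_hard_core) (simp add: L_def)
  define bad where "bad = (\<Union>d\<in>lattice_steps. {x \<in> L. x + d \<notin> K})"
  have "card bad \<le> (\<Sum>d\<in>lattice_steps. card {x \<in> L. x + d \<notin> K})"
    unfolding bad_def using finite_lattice_steps by (rule card_UN_le)
  then have "real (card bad) \<le> (\<Sum>d\<in>lattice_steps. real (card {x \<in> L. x + d \<notin> K}))"
    by (simp flip: of_nat_sum)
  also have "\<dots> \<le> (\<Sum>d\<in>lattice_steps. 4 * r + 1)"
    unfolding L_def using r[unfolded L_def] \<open>0 \<le> r\<close> by (intro sum_mono exit_points_card[OF \<open>convex K\<close>]) auto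
  finally have bad: "real (card bad) \<le> 8 * (4 * r + 1)" by (simp add: card_lattice_steps)
  have "bad \<subseteq> L" by (auto simp: bad_def)
  have full: "8 \<le> card (nearest_neighbors L x)" if x: "x \<in> L - bad" for x
  proof -
    have "(+) x ` lattice_steps \<subseteq> nearest_neighbors L x"
    proof
      fix y assume "y \<in> (+) x ` lattice_steps"
      then obtain d where d: "d \<in> lattice_steps" "y = x + d" by auto
      then have "y \<in> L" using x square_lattice_add lattice_steps_props(1)[OF d(1)] by (auto simp: bad_def L_def)
      then show "y \<in> nearest_neighbors L x"
        using x d lattice_steps_props(4,5)[OF d(1)] by (subst nearest_neighbors_altdef[OF hc]) (auto simp: dist_norm)
    qed
    moreover have "finite (nearest_neighbors L x)" using \<open>finite L\<close> by (simp add: nearest_neighbors_def)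
    ultimately show ?thesis using card_mono[of "nearest_neighbors L x" "(+) x ` lattice_steps"]
      by (simp add: card_image card_lattice_steps)
  qed
  have "8 * (real (card L) - real (card bad)) = (\<Sum>x\<in>L - bad. 8)"
    using card_Diff_subset[of bad L] \<open>bad \<subseteq> L\<close> \<open>finite L\<close> card_mono[of L bad]
    by (simp add: finite_subset of_nat_diff)
  also have "\<dots> \<le> (\<Sum>x\<in>L - bad. real (card (nearest_neighbors L x)))"
    using full by (intro sum_mono) (metis of_nat_mono of_nat_numeral)
  also have "\<dots> \<le> (\<Sum>x\<in>L. real (card (nearest_neighbors L x)))"
    using \<open>finite L\<close> by (intro sum_mono2) auto
  finally show ?thesis using bad by (simp add: energy_hard_core[OF hc \<open>finite L\<close>])
qed

section \<open>Energy per particle\<close>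

lemma infinite_square_lattice: "infinite square_lattice"
proof
  assume fin: "finite square_lattice"
  have "inj (\<lambda>n::nat. pt (real n) 0)" by (auto simp: inj_def vec2_eq_iff)
  moreover have "range (\<lambda>n::nat. pt (real n) 0) \<subseteq> square_lattice"
    by (auto simp: square_lattice_altdef)
  ultimately show False using fin by (metis finite_subset infinite_UNIV_nat finite_imageD)
qed

text \<open>The rows of a box of width about \<open>sqrt N\<close> are filled one after the other; the last row may be incomplete.
  A single linear inequality describes where the filling stops, so the result consists
  of the lattice points of a convex set. The width is \<open>\<lceil>sqrt N\<rceil> + 1\<close>, which is positive even for \<open>N = 0\<close>.\<close>

lemma row_filling_energy:
  obtains L where "L \<subseteq> square_lattice" "finite L" "card L = N"
    "energy sticky_potential L \<le> ereal (- 4 * real N + (128 * sqrt (real N) + 288))"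
proof -
  define m where "m = nat \<lceil>sqrt (real N)\<rceil> + 1"
  have m0: "0 < m" by (simp add: m_def)
  have m_lower: "sqrt (real N) \<le> real m" and m_upper: "real m \<le> sqrt (real N) + 2"
  proof -
    have "real m = of_int \<lceil>sqrt (real N)\<rceil> + 1" by (simp add: m_def)
    then show "sqrt (real N) \<le> real m" "real m \<le> sqrt (real N) + 2" by linarith+
  qed
  define K :: "(real ^ 2) set" where
    "K = {x. 0 \<le> x $ 1 \<and> x $ 1 \<le> real m - 1 \<and> 0 \<le> x $ 2 \<and> real m * x $ 2 + x $ 1 \<le> real N - 1}"
  define L where "L = square_lattice \<inter> K"
  define f where "f k = pt (real (k mod m)) (real (k div m))" for k :: nat
  have inj: "inj f"
  proof (rule injI)
    fix k l assume "f k = f l"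
    then have "k mod m = l mod m" "k div m = l div m" by (auto simp: f_def vec2_eq_iff)
    then show "k = l" by (metis div_mult_mod_eq)
  qed
  have L: "L = f ` {..<N}"
  proof
    show "L \<subseteq> f ` {..<N}"
    proof
      fix x assume x: "x \<in> L"
      then obtain a b :: int where ab: "x $ 1 = of_int a" "x $ 2 = of_int b"
        by (auto simp: L_def square_lattice_altdef elim!: Ints_cases)
      have r: "0 \<le> a" "0 \<le> b" using x ab by (auto simp: L_def K_def)
      then obtain i j :: nat where ij: "a = int i" "b = int j" by (metis nonneg_int_cases)
      have "real i \<le> real m - 1" "real m * real j + real i \<le> real N - 1"
        using x ab ij by (auto simp: L_def K_def)
      then have "real (i + 1) \<le> real m" "real (m * j + i + 1) \<le> real N" by auto
      then have "i < m" "m * j + i < N" unfolding of_nat_le_iff by auto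
      then have "x = f (m * j + i)" "m * j + i \<in> {..<N}" using ab ij by (auto simp: f_def vec2_eq_iff)
      then show "x \<in> f ` {..<N}" by blast
    qed
    show "f ` {..<N} \<subseteq> L"
    proof
      fix x assume "x \<in> f ` {..<N}"
      then obtain k where k: "k < N" "x = f k" by auto
      have "k mod m + 1 \<le> m" using m0 by (simp add: Suc_le_eq)
      then have "real (k mod m + 1) \<le> real m" unfolding of_nat_le_iff .
      moreover have "real m * real (k div m) + real (k mod m) = real k"
        by (metis mult_div_mod_eq of_nat_add of_nat_mult)
      moreover have "real k \<le> real N - 1" using k by linarith
      ultimately show "x \<in> L" using k by (simp add: L_def K_def f_def square_lattice_altdef)
    qed
  qed
  have fin: "finite L" using L by simp
  have card: "card L = N" using L inj by (simp add: card_image inj_on_subset)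
  have "convex K"
    unfolding convex_alt
  proof (intro ballI allI impI)
    fix x y u assume xy: "x \<in> K" "y \<in> K" and u: "0 \<le> u \<and> u \<le> (1::real)"
    have lin: "(1 - u) * a + u * b \<le> c" if "a \<le> c" "b \<le> c" for a b c :: real
      using convex_bound_le[of a c b "1 - u" u] that u by simp
    have lin0: "0 \<le> (1 - u) * a + u * b" if "0 \<le> a" "0 \<le> b" for a b :: real
      using that u by simp
    have "real m * ((1 - u) * x $ 2 + u * y $ 2) + ((1 - u) * x $ 1 + u * y $ 1) =
        (1 - u) * (real m * x $ 2 + x $ 1) + u * (real m * y $ 2 + y $ 1)"
      by (simp add: algebra_simps)
    then show "(1 - u) *\<^sub>R x + u *\<^sub>R y \<in> K"
      using xy lin lin0 unfolding K_def by simp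
  qed
  moreover have "\<bar>x $ 1\<bar> \<le> sqrt (real N) + 2 \<and> \<bar>x $ 2\<bar> \<le> sqrt (real N) + 2" if "x \<in> L" for x
  proof -
    have x: "0 \<le> x $ 1" "x $ 1 \<le> real m - 1" "0 \<le> x $ 2" "real m * x $ 2 + x $ 1 \<le> real N - 1"
      using that by (auto simp: L_def K_def)
    then have "real m * x $ 2 \<le> sqrt (real N) * sqrt (real N)" by simp
    also have "\<dots> \<le> real m * sqrt (real N)" using m_lower by (intro mult_right_mono) auto
    finally have "x $ 2 \<le> sqrt (real N)" using m0 by simp
    then show ?thesis using x m_upper by auto
  qed
  ultimately have "energy sticky_potential L \<le> ereal (- 4 * real (card L) + 32 * (4 * (sqrt (real N) + 2) + 1))"
    using fin unfolding L_def by (intro energy_lattice_convex) auto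
  then show thesis using that[of L] fin card by (simp add: L_def algebra_simps)
qed

lemma min_energy_bounds:
  assumes "square_lattice \<subseteq> A"
  shows "ereal (- 4 * real N) \<le> min_energy_in A sticky_potential N"
    "min_energy_in A sticky_potential N \<le> ereal (- 4 * real N + (128 * sqrt (real N) + 288))"
proof -
  have "infinite A" using assms infinite_square_lattice finite_subset by blast
  then show "ereal (- 4 * real N) \<le> min_energy_in A sticky_potential N"
    using energy_lower_bound by (metis min_energy_attained)
  show "min_energy_in A sticky_potential N \<le> ereal (- 4 * real N + (128 * sqrt (real N) + 288))"
    using row_filling_energy[of N] min_energy_le assms by (metis order_trans)
qed

lemma ereal_quotient_sandwich:
  fixes E :: "'a \<Rightarrow> ereal"
  assumes "eventually (\<lambda>x. 0 < n x \<and> ereal (c * n x) \<le> E x \<and> E x \<le> ereal (c * n x + b x)) F"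
    and "((\<lambda>x. b x / n x) \<longlongrightarrow> 0) F"
  shows "((\<lambda>x. E x / ereal (n x)) \<longlongrightarrow> ereal c) F"
proof (rule tendsto_sandwich)
  show "\<forall>\<^sub>F x in F. ereal c \<le> E x / ereal (n x)"
    using assms(1)
  proof eventually_elim
    case (elim x)
    then have "ereal (c * n x) / ereal (n x) \<le> E x / ereal (n x)"
      by (intro ereal_divide_right_mono) auto
    then show ?case using elim by simp
  qed
  show "\<forall>\<^sub>F x in F. E x / ereal (n x) \<le> ereal (c + b x / n x)"
    using assms(1)
  proof eventually_elim
    case (elim x)
    then have "E x / ereal (n x) \<le> ereal (c * n x + b x) / ereal (n x)"
      by (intro ereal_divide_right_mono) auto
    also have "\<dots> = ereal (c + b x / n x)" using elim by (simp add: add_divide_distrib)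
    finally show ?case .
  qed
  show "((\<lambda>x. ereal c) \<longlongrightarrow> ereal c) F" by simp
  show "((\<lambda>x. ereal (c + b x / n x)) \<longlongrightarrow> ereal c) F"
    using tendsto_add[OF tendsto_const assms(2), of c] by simp
qed

lemma lattice_energy_per_particle:
  "(\<lambda>N. lattice_min_energy sticky_potential N / ereal (real N)) \<longlonglongrightarrow> ereal (- 4)"
proof (rule ereal_quotient_sandwich[where b = "\<lambda>N. 128 * sqrt (real N) + 288"])
  show "\<forall>\<^sub>F N in sequentially. 0 < real N \<and> ereal (- 4 * real N) \<le> lattice_min_energy sticky_potential N \<and>
      lattice_min_energy sticky_potential N \<le> ereal (- 4 * real N + (128 * sqrt (real N) + 288))"
    using eventually_gt_at_top[of 0] by eventually_elim (use min_energy_bounds in auto)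
  show "(\<lambda>N. (128 * sqrt (real N) + 288) / real N) \<longlonglongrightarrow> 0" by real_asymp
qed

lemma ball_component_le: "x \<in> ball 0 R \<Longrightarrow> \<bar>x $ i\<bar> \<le> R" for x :: "real ^ 2"
  using component_le_norm_cart[of x i] by simp

lemma finite_lattice_ball: "finite (square_lattice \<inter> ball 0 R)"
proof (rule finite_subset)
  let ?I = "{- \<lfloor>R\<rfloor>..\<lfloor>R\<rfloor>}"
  show "square_lattice \<inter> ball 0 R \<subseteq> (\<lambda>(a, b). pt (of_int a) (of_int b)) ` (?I \<times> ?I)"
  proof
    fix x :: "real ^ 2" assume x: "x \<in> square_lattice \<inter> ball 0 R"
    then obtain a b :: int where ab: "x $ 1 = of_int a" "x $ 2 = of_int b"
      by (auto simp: square_lattice_altdef elim!: Ints_cases)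
    have "\<bar>x $ 1\<bar> \<le> R" "\<bar>x $ 2\<bar> \<le> R"
      using x ball_component_le[of x R] by auto
    then have "a \<in> ?I" "b \<in> ?I" using ab by (auto simp: abs_le_iff le_floor_iff minus_le_iff)
    moreover have "x = pt (of_int a) (of_int b)" using ab by (simp add: vec2_eq_iff)
    ultimately show "x \<in> (\<lambda>(a, b). pt (of_int a) (of_int b)) ` (?I \<times> ?I)" by auto
  qed
qed simp

text \<open>The ball contains the square \<open>[0, R/2]\<^sup>2\<close>, as its diagonal is shorter than \<open>R\<close>.\<close>

lemma card_lattice_ball_lower:
  assumes "0 < R"
  shows "R\<^sup>2 / 4 \<le> real (card (square_lattice \<inter> ball 0 R))"
proof -
  define n where "n = nat \<lfloor>R / 2\<rfloor>"
  have n: "real n \<le> R / 2" "R / 2 \<le> real (Suc n)" using assms unfolding n_def by linarith+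
  let ?f = "\<lambda>(a :: nat, b :: nat). pt (real a) (real b)"
  have inj: "inj_on ?f ({..n} \<times> {..n})" by (auto simp: inj_on_def vec2_eq_iff)
  have "?f ` ({..n} \<times> {..n}) \<subseteq> square_lattice \<inter> ball 0 R"
  proof clarify
    fix a b assume "a \<le> n" "b \<le> n"
    then have ab: "real a \<le> R / 2" "real b \<le> R / 2" using n by linarith+
    have "(real a)\<^sup>2 + (real b)\<^sup>2 \<le> (R / 2)\<^sup>2 + (R / 2)\<^sup>2"
      using ab by (intro add_mono power_mono) auto
    also have "\<dots> < R\<^sup>2" using assms by (simp add: power2_eq_square)
    finally have "sqrt ((real a)\<^sup>2 + (real b)\<^sup>2) < sqrt (R\<^sup>2)" by (rule real_sqrt_less_mono)
    then show "pt (real a) (real b) \<in> square_lattice \<inter> ball 0 R"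
      using assms by (simp add: square_lattice_altdef dist_norm norm_vec2)
  qed
  then have "card ({..n} \<times> {..n}) \<le> card (square_lattice \<inter> ball 0 R)"
    using card_mono[OF finite_lattice_ball] card_image[OF inj] by metis
  then have "real (Suc n * Suc n) \<le> real (card (square_lattice \<inter> ball 0 R))"
    unfolding of_nat_le_iff by (simp add: card_cartesian_product)
  moreover have "(R / 2)\<^sup>2 \<le> (real (Suc n))\<^sup>2" using n assms by (intro power_mono) auto
  ultimately show ?thesis by (simp add: power2_eq_square algebra_simps)
qed

lemma ball_energy_per_particle:
  "((\<lambda>R::real. energy sticky_potential (square_lattice \<inter> ball 0 R)
      / ereal (real (card (square_lattice \<inter> ball 0 R)))) \<longlongrightarrow> ereal (- 4)) at_top"
proof (rule ereal_quotient_sandwich[where b = "\<lambda>R. 32 * (4 * R + 1)"])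
  show "\<forall>\<^sub>F R in at_top. 0 < real (card (square_lattice \<inter> ball 0 R :: (real^2) set)) \<and>
      ereal (- 4 * real (card (square_lattice \<inter> ball 0 R))) \<le> energy sticky_potential (square_lattice \<inter> ball 0 R) \<and>
      energy sticky_potential (square_lattice \<inter> ball 0 R) \<le> ereal (- 4 * real (card (square_lattice \<inter> ball 0 R)) + 32 * (4 * R + 1))"
    using eventually_gt_at_top[of "0::real"]
  proof eventually_elim
    case (elim R)
    have "0 < R\<^sup>2 / 4" using elim by simp
    then have "0 < real (card (square_lattice \<inter> ball 0 R))"
      using card_lattice_ball_lower[OF elim] by linarith
    moreover have "\<bar>x $ 1\<bar> \<le> R \<and> \<bar>x $ 2\<bar> \<le> R" if "x \<in> square_lattice \<inter> ball 0 R" for x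
      using that ball_component_le[of x R] by auto
    ultimately show ?case
      using energy_lower_bound[OF finite_lattice_ball[of R]] elim
        energy_lattice_convex[OF convex_ball finite_lattice_ball, of R R] by auto
  qed
  show "((\<lambda>R. 32 * (4 * R + 1) / real (card (square_lattice \<inter> ball 0 R))) \<longlongrightarrow> 0) at_top"
  proof (rule tendsto_sandwich)
    show "\<forall>\<^sub>F R in at_top. 0 \<le> 32 * (4 * R + 1) / real (card (square_lattice \<inter> ball 0 R))"
      using eventually_gt_at_top[of "0::real"] by eventually_elim simp
    show "\<forall>\<^sub>F R in at_top. 32 * (4 * R + 1) / real (card (square_lattice \<inter> ball 0 R)) \<le> 32 * (4 * R + 1) / (R\<^sup>2 / 4)"
      using eventually_gt_at_top[of "0::real"]
    proof eventually_elim
      case (elim R)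
      then have pos: "0 < R\<^sup>2 / 4" by simp
      with card_lattice_ball_lower[OF elim] have "0 < real (card (square_lattice \<inter> ball 0 R))"
        by linarith
      with pos show ?case using card_lattice_ball_lower[OF elim] elim
        by (intro divide_left_mono mult_pos_pos) auto
    qed
    show "((\<lambda>R::real. 32 * (4 * R + 1) / (R\<^sup>2 / 4)) \<longlongrightarrow> 0) at_top" by real_asymp
  qed simp
qed

section \<open>The neighborhood in Cartesian coordinates\<close>

lemma lattice_cball:
  "cball 0 (sqrt 2) \<inter> square_lattice = {z :: real ^ 2. \<forall>i. z $ i \<in> {-1, 0, 1}}"
proof -
  have *: "a\<^sup>2 + b\<^sup>2 \<le> 2 \<longleftrightarrow> a \<in> {-1, 0, 1} \<and> b \<in> {-1, 0, 1}" if "a \<in> \<int>" "b \<in> \<int>" for a b :: real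
  proof
    assume le: "a\<^sup>2 + b\<^sup>2 \<le> 2"
    have cases: "c \<in> {-1, 0, 1}" if "c \<in> \<int>" "c\<^sup>2 \<le> 2" for c :: real
    proof -
      obtain k :: int where k: "c = of_int k" using \<open>c \<in> \<int>\<close> by (elim Ints_cases)
      have "\<bar>c\<bar>\<^sup>2 < 2\<^sup>2" using that by simp
      then have "\<bar>c\<bar> < 2" by (rule power2_less_imp_less) simp
      then have "\<bar>k\<bar> < 2" using k by linarith
      then have "k \<in> {-1, 0, 1}" by auto
      then show ?thesis using k by auto
    qed
    show "a \<in> {-1, 0, 1} \<and> b \<in> {-1, 0, 1}"
    proof -
      have "a\<^sup>2 \<le> 2" "b\<^sup>2 \<le> 2" using le zero_le_power2[of a] zero_le_power2[of b] by linarith+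
      then show "a \<in> {-1, 0, 1} \<and> b \<in> {-1, 0, 1}" using cases that by blast
    qed
  qed auto
  show ?thesis
  proof (intro set_eqI)
    fix z :: "real ^ 2"
    have "z $ i \<in> {-1, 0, 1} \<Longrightarrow> z $ i \<in> \<int>" for i by auto
    then show "z \<in> cball 0 (sqrt 2) \<inter> square_lattice \<longleftrightarrow> z \<in> {z. \<forall>i. z $ i \<in> {-1, 0, 1}}"
      using *[of "z $ 1" "z $ 2"]
      by (auto simp: dist_norm norm_vec2 square_lattice_altdef forall_2)
  qed
qed

text \<open>The matrix of the multiplication by \<open>v\<close> in the real basis \<open>1, \<i>\<close>.\<close>

definition rotation_by :: "complex \<Rightarrow> real ^ 2 ^ 2" where
  "rotation_by v = vector [vector [Re v, - Im v], vector [Im v, Re v]]"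

lemma rotation_matrix_rotation_by:
  assumes "cmod v = 1"
  shows "rotation_matrix (rotation_by v)"
proof -
  have v: "Re v * Re v + Im v * Im v = 1"
    using assms by (simp add: cmod_def power2_eq_square)
  then show ?thesis
    by (simp add: rotation_matrix_def orthogonal_matrix rotation_by_def det_2 vec_eq_iff forall_2
        matrix_matrix_mult_def sum_2 transpose_def mat_def mult.commute add.commute)
qed

lemma to_complex_rotation_by: "to_complex (a + rotation_by v *v z) = to_complex a + v * to_complex z"
  by (simp add: to_complex_def rotation_by_def matrix_vector_mult_def sum_2 complex_eq_iff)

lemma to_complex_image_lattice_cball:
  "to_complex ` (cball 0 (sqrt 2) \<inter> square_lattice) = insert 0 king_moves"
proof -
  have "to_complex ` {z. \<forall>i. z $ i \<in> {-1, 0, 1}} = {Complex a b | a b. a \<in> {-1, 0, 1} \<and> b \<in> {-1, 0, 1}}"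
  proof (intro equalityI subsetI)
    fix w assume "w \<in> {Complex a b | a b. a \<in> {-1, 0, 1} \<and> b \<in> {-1, 0, 1}}"
    then obtain a b where "w = Complex a b" "a \<in> {-1, 0, 1}" "b \<in> {-1, 0, 1}" by blast
    then have "w = to_complex (pt a b)" "pt a b \<in> {z. \<forall>i. z $ i \<in> {-1, 0, 1}}"
      by (simp_all add: to_complex_def forall_2)
    then show "w \<in> to_complex ` {z. \<forall>i. z $ i \<in> {-1, 0, 1}}" by blast
  qed (auto simp: to_complex_def forall_2)
  also have "\<dots> = insert 0 king_moves"
    by (auto simp: king_moves_def complex_eq_iff)
  finally show ?thesis unfolding lattice_cball .
qed

lemma rotated_lattice_neighborhood:
  assumes X: "X \<in> hard_core_configs" "x \<in> X" and card: "card (nearest_neighbors X x) = 8"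
    and full: "\<And>y. y \<in> nearest_neighbors X x \<Longrightarrow> card (nearest_neighbors X y) = 8"
  shows "\<exists>(Q :: real ^ 2 ^ 2) a. rotation_matrix Q \<and>
         cball x (sqrt 2) \<inter> X = (\<lambda>z. a + Q *v z) ` (cball 0 (sqrt 2) \<inter> square_lattice)"
proof -
  obtain v where v: "cmod v = 1"
    "nbrs (to_complex ` X) (to_complex x) = (\<lambda>w. to_complex x + v * w) ` king_moves"
  proof (rule full_neighborhood_king_moves[OF hard_core_to_complex[OF X(1)], of "to_complex x"])
    show "to_complex x \<in> to_complex ` X" using X by simp
    show "card (nbrs (to_complex ` X) (to_complex x)) = 8" using card card_nbrs_to_complex[OF X] by simp
    fix y assume "y \<in> nbrs (to_complex ` X) (to_complex x)"
    then obtain z where z: "z \<in> nearest_neighbors X x" "y = to_complex z"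
      unfolding nbrs_to_complex[OF X] by auto
    then have "z \<in> X" by (simp add: nearest_neighbors_def)
    then show "card (nbrs (to_complex ` X) y) = 8"
      using full[OF z(1)] card_nbrs_to_complex[OF X(1)] z(2) by simp
  qed
  have "cball x (sqrt 2) \<inter> X = insert x (nearest_neighbors X x)"
    using X(2) by (auto simp: nearest_neighbors_altdef[OF X])
  then have "to_complex ` (cball x (sqrt 2) \<inter> X) = (\<lambda>w. to_complex x + v * w) ` insert 0 king_moves"
    using v(2) by (simp add: nbrs_to_complex[OF X])
  also have "\<dots> = to_complex ` (\<lambda>z. x + rotation_by v *v z) ` (cball 0 (sqrt 2) \<inter> square_lattice)"
    unfolding to_complex_image_lattice_cball[symmetric] image_image to_complex_rotation_by ..
  finally have "cball x (sqrt 2) \<inter> X = (\<lambda>z. x + rotation_by v *v z) ` (cball 0 (sqrt 2) \<inter> square_lattice)"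
    by (simp only: inj_image_eq_iff[OF inj_to_complex])
  then show ?thesis using rotation_matrix_rotation_by[OF v(1)] by blast
qed

theorem theorem2p1:
  "((\<forall>N::nat. ereal (- 4 * real N) \<le> min_energy sticky_potential N) \<and>
    (\<exists>g :: nat \<Rightarrow> real. g \<in> O(\<lambda>N. sqrt (real N)) \<and>
       (\<forall>N. min_energy sticky_potential N \<le> ereal (- 4 * real N + g N))) \<and>
    ((\<lambda>N. lattice_min_energy sticky_potential N / ereal (real N)) \<longlonglongrightarrow> ereal (- 4)) \<and>
    ((\<lambda>R::real. energy sticky_potential (square_lattice \<inter> ball 0 R)
        / ereal (real (card (square_lattice \<inter> ball 0 R)))) \<longlongrightarrow> ereal (- 4)) at_top) \<and>
   (\<forall>X\<in>hard_core_configs. \<forall>x\<in>X.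
      card (nearest_neighbors X x) = 8 \<longrightarrow>
      (\<forall>y\<in>nearest_neighbors X x. card (nearest_neighbors X y) = 8) \<longrightarrow>
      (\<exists>(Q :: real ^ 2 ^ 2) a. rotation_matrix Q \<and>
         cball x (sqrt 2) \<inter> X = (\<lambda>z. a + Q *v z) ` (cball 0 (sqrt 2) \<inter> square_lattice))) \<and>
   cball 0 (sqrt 2) \<inter> square_lattice = {z :: real ^ 2. \<forall>i. z $ i \<in> {-1, 0, 1}}"
proof (intro conjI allI impI ballI)
  show "\<exists>g :: nat \<Rightarrow> real. g \<in> O(\<lambda>N. sqrt (real N)) \<and>
       (\<forall>N. min_energy sticky_potential N \<le> ereal (- 4 * real N + g N))"
  proof (intro exI conjI allI)
    show "(\<lambda>N. 128 * sqrt (real N) + 288) \<in> O(\<lambda>N. sqrt (real N))" by real_asymp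
    show "min_energy sticky_potential N \<le> ereal (- 4 * real N + (128 * sqrt (real N) + 288))" for N
      by (rule min_energy_bounds) simp
  qed
  show "ereal (- 4 * real N) \<le> min_energy sticky_potential N" for N
    by (rule min_energy_bounds) simp
qed (use lattice_energy_per_particle ball_energy_per_particle lattice_cball
    rotated_lattice_neighborhood in auto)

end
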